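(* Let $\Sigma=\{0,1\}$. For each $t,c,a\in\{\mathrm{Y},\mathrm{N},\ast\}$, there exists a $(\mathrm{Y},t,c,a)$-OWF if and only if $\mathrm{P}\neq\mathrm{NP}$.
   Context: All functions considered are partial functions $\sigma:\Sigma^*\times\Sigma^*\to\Sigma^*$ (possibly undefined on some pairs), with $\Sigma=\{0,1\}$. $\langle\cdot,\cdot\rangle$ is a standard pairing function: a total, polynomial-time computable bijection $\Sigma^*\times\Sigma^*\to\Sigma^*$ with polynomial-time computable inverses, nondecreasing in each argument when the other is fixed. FP is the class of (total or partial) polynomial-time computable functions. - $\sigma$ is honest if there is a polynomial $p$ such that every $z\in\mathrm{image}(\sigma)$ has some $(x,y)\in\mathrm{domain}(\sigma)$ with $\sigma(x,y)=z$ and $|x|+|y|\le p(|z|)$. - $\sigma$ is noninvertible if there is no $f\in\mathrm{FP}$ with $\sigma(f(z))=z$ for all $z\in\mathrm{image}(\sigma)$. - $\sigma$ is a one-way function if it is polynomial-time computable, honest and noninvertible. - $\sigma$ is total if it is defined on every pair, and nontotal otherwise. - Let $\Gamma=\Sigma^*\cup\{\bot\}$ and $\hat\sigma:\Gamma\times\Gamma\to\Gamma$, where $\hat\sigma(x,y)=\sigma(x,y)$ if $x\ne\bot$, $y\ne\bot$ and $(x,y)\in\mathrm{domain}(\sigma)$, and $\hat\sigma(x,y)=\bot$ otherwise. $\sigma$ is associative if $\hat\sigma(\hat\sigma(x,y),z)=\hat\sigma(x,\hat\sigma(y,z))$ for all $x,y,z\in\Sigma^*$. It is commutative if $\hat\sigma(x,y)=\hat\sigma(y,x)$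 for all $x,y\in\Sigma^*$. - $\sigma$ is s-honest if there is a polynomial $p$ such that (a) whenever $\sigma(x,y)=z$ for some $y$, there is $\hat y$ with $\sigma(x,\hat y)=z$ and $|\hat y|\le p(|x|+|z|)$; and (b) whenever $\sigma(x,y)=z$ for some $x$, there is $\hat x$ with $\sigma(\hat x,y)=z$ and $|\hat x|\le p(|y|+|z|)$. - $\sigma$ is invertible with respect to the first argument if there is $g_1\in\mathrm{FP}$ such that for all $z\in\mathrm{image}(\sigma)$ and all $(x,y)\in\mathrm{domain}(\sigma)$ with $\sigma(x,y)=z$, we have $\sigma(x,g_1(\langle x,z\rangle))=z$. It is invertible with respect to the second argument if there is $g_2\in\mathrm{FP}$ such that for all such $z,x,y$, we have $\sigma(g_2(\langle y,z\rangle),y)=z$. - $\sigma$ is strongly noninvertible if it is invertible with respect to neither argument. - $\sigma$ is strong if it is polynomial-time computable, s-honest and strongly noninvertible. - For $s,t,c,a\in\{\mathrm{Y},\mathrm{N},\ast\}$, $\sigma$ is an $(s,t,c,a)$-OWF if $\sigma$ is a one-way function and all of the following hold: if $s=\mathrm{Y}$ then $\sigma$ is strong, and if $s=\mathrm{N}$ then it is not strong; if $t=\mathrm{Y}$ it is total, and if $t=\mathrm{N}$ it is nontotal; if $c=\mathrm{Y}$ it is commutative, and if $c=\mathrm{N}$ it is not commutative; if $a=\mathrm{Y}$ it is associative, and if $a=\mathrm{N}$ it is not associative. The value $\ast$ imposes no condition. *)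

theory Defs
  imports "HOL-Computational_Algebra.Polynomial"
begin

type_synonym word = "bool list"

text \<open>
  Deterministic multitape Turing machines. A two-way infinite tape is stored relative to its head:
  cell \<open>0\<close> is the scanned cell, so a head movement shifts the contents. Symbol \<open>0\<close> is the blank,
  \<open>1\<close> and \<open>2\<close> are the input letters.
\<close>

type_synonym tape = "int \<Rightarrow> nat"

type_synonym config = "nat \<times> tape list"

record tm =
  states :: nat
  tapes :: nat
  symbols :: nat
  start :: nat
  accept :: nat
  reject :: nat
  delta :: "nat \<Rightarrow> nat list \<Rightarrow> nat \<times> (nat \<times> int) list"

text \<open>
  States are \<open>{..<states M}\<close> and tape symbols \<open>{..<symbols M}\<close>; \<open>delta\<close> maps a state and the
  scanned symbols to the new state and, per tape, the symbol written and the head movement.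
  Values of \<open>delta\<close> outside the range constrained here are never used in a run.
\<close>

definition wf_tm :: "tm \<Rightarrow> bool" where
  "wf_tm M \<longleftrightarrow>
     3 \<le> symbols M \<and> start M < states M \<and> accept M < states M \<and> reject M < states M \<and>
     accept M \<noteq> reject M \<and>
     (\<forall>q as. q < states M \<and> length as = tapes M \<and> set as \<subseteq> {..<symbols M} \<longrightarrow>
        (case delta M q as of (q', acts) \<Rightarrow>
           q' < states M \<and> length acts = tapes M \<and> set acts \<subseteq> {..<symbols M} \<times> {-1, 0, 1}))"

definition act :: "nat \<times> int \<Rightarrow> tape \<Rightarrow> tape" where
  "act = (\<lambda>(b, d) tp i. (tp(0 := b)) (i + d))"

definition step :: "tm \<Rightarrow> config \<Rightarrow> config" where
  "step M = (\<lambda>(q, tps).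
     if q = accept M \<or> q = reject M then (q, tps)
     else (case delta M q (map (\<lambda>tp. tp 0) tps) of (q', acts) \<Rightarrow> (q', map2 act acts tps)))"

definition letter :: "bool \<Rightarrow> nat" where
  "letter b = (if b then 2 else 1)"

definition inscription :: "word \<Rightarrow> tape" where
  "inscription x i = (if 0 \<le> i \<and> i < int (length x) then letter (x ! nat i) else 0)"

definition initial :: "tm \<Rightarrow> word list \<Rightarrow> config" where
  "initial M xs = (start M, map inscription xs @ replicate (tapes M - length xs) (inscription []))"

text \<open>The word shown by a tape extends from the head to the first blank on its right.\<close>

definition shows_word :: "tape \<Rightarrow> word \<Rightarrow> bool" where
  "shows_word tp y \<longleftrightarrow> (\<forall>i<length y. tp (int i) = letter (y ! i)) \<and> tp (int (length y)) = 0"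

text \<open>
  Rejection means that the value is undefined; acceptance delivers the output words on the first
  tapes. Halting configurations are fixed points of \<open>step\<close>, so the configuration after exactly \<open>T\<close>
  steps is halting iff the machine halts within \<open>T\<close> steps.
\<close>

definition yields_within :: "tm \<Rightarrow> word list \<Rightarrow> nat \<Rightarrow> word list option \<Rightarrow> bool" where
  "yields_within M xs T r \<longleftrightarrow>
     (case (step M ^^ T) (initial M xs) of (q, tps) \<Rightarrow>
        (case r of
           None \<Rightarrow> q = reject M
         | Some ys \<Rightarrow> q = accept M \<and> length ys \<le> length tps \<and>
                      (\<forall>i<length ys. shows_word (tps ! i) (ys ! i))))"

definition polytime :: "nat \<Rightarrow> (word list \<Rightarrow> word list option) \<Rightarrow> bool" where
  "polytime k f \<longleftrightarrow>
     (\<exists>M (p :: nat poly). wf_tm M \<and> k \<le> tapes M \<and>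
        (\<forall>xs. length xs = k \<longrightarrow> yields_within M xs (poly p (sum_list (map length xs))) (f xs)))"

definition FP :: "(word \<rightharpoonup> word) set" where
  "FP = {f. polytime 1 (\<lambda>xs. map_option (\<lambda>y. [y]) (f (xs ! 0)))}"

definition FP_from_pairs :: "(word \<times> word \<rightharpoonup> word) set" where
  "FP_from_pairs = {f. polytime 2 (\<lambda>xs. map_option (\<lambda>z. [z]) (f (xs ! 0, xs ! 1)))}"

definition FP_to_pairs :: "(word \<rightharpoonup> word \<times> word) set" where
  "FP_to_pairs = {f. polytime 1 (\<lambda>xs. map_option (\<lambda>(x, y). [x, y]) (f (xs ! 0)))}"

definition class_P :: "word set set" where
  "class_P = {L. polytime 1 (\<lambda>xs. if xs ! 0 \<in> L then Some [] else None)}"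

definition class_P_pairs :: "(word \<times> word) set set" where
  "class_P_pairs = {R. polytime 2 (\<lambda>xs. if (xs ! 0, xs ! 1) \<in> R then Some [] else None)}"

definition class_NP :: "word set set" where
  "class_NP = {L. \<exists>R \<in> class_P_pairs. \<exists>p :: nat poly. \<forall>x.
     x \<in> L \<longleftrightarrow> (\<exists>w. length w \<le> poly p (length x) \<and> (x, w) \<in> R)}"

text \<open>Words are ordered by length first and lexicographically within each length.\<close>

definition word_le :: "word \<Rightarrow> word \<Rightarrow> bool" where
  "word_le x y \<longleftrightarrow> x = y \<or> (x, y) \<in> lenlex {(False, True)}"

definition standard_pairing :: "(word \<times> word \<Rightarrow> word) \<Rightarrow> bool" where
  "standard_pairing pr \<longleftrightarrow>
     bij pr \<and>
     (\<lambda>u. Some (pr u)) \<in> FP_from_pairs \<and>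
     (\<lambda>w. Some (fst (inv pr w))) \<in> FP \<and>
     (\<lambda>w. Some (snd (inv pr w))) \<in> FP \<and>
     (\<forall>x x' y. word_le x x' \<longrightarrow> word_le (pr (x, y)) (pr (x', y))) \<and>
     (\<forall>x y y'. word_le y y' \<longrightarrow> word_le (pr (x, y)) (pr (x, y')))"

type_synonym pfun2 = "word \<times> word \<rightharpoonup> word"

definition honest :: "pfun2 \<Rightarrow> bool" where
  "honest \<sigma> \<longleftrightarrow> (\<exists>p :: nat poly. \<forall>z \<in> ran \<sigma>. \<exists>x y.
     \<sigma> (x, y) = Some z \<and> length x + length y \<le> poly p (length z))"

definition noninvertible :: "pfun2 \<Rightarrow> bool" where
  "noninvertible \<sigma> \<longleftrightarrow>
     \<not> (\<exists>f \<in> FP_to_pairs. \<forall>z \<in> ran \<sigma>. \<exists>u. f z = Some u \<and> \<sigma> u = Some z)"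

definition one_way :: "pfun2 \<Rightarrow> bool" where
  "one_way \<sigma> \<longleftrightarrow> \<sigma> \<in> FP_from_pairs \<and> honest \<sigma> \<and> noninvertible \<sigma>"

definition is_total :: "pfun2 \<Rightarrow> bool" where
  "is_total \<sigma> \<longleftrightarrow> dom \<sigma> = UNIV"

text \<open>\<open>None\<close> plays the role of \<open>\<bottom>\<close>.\<close>

fun hat :: "pfun2 \<Rightarrow> word option \<Rightarrow> word option \<Rightarrow> word option" where
  "hat \<sigma> (Some x) (Some y) = \<sigma> (x, y)"
| "hat \<sigma> _ _ = None"

definition associative :: "pfun2 \<Rightarrow> bool" where
  "associative \<sigma> \<longleftrightarrow> (\<forall>x y z.
     hat \<sigma> (hat \<sigma> (Some x) (Some y)) (Some z) = hat \<sigma> (Some x) (hat \<sigma> (Some y) (Some z)))"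

definition commutative :: "pfun2 \<Rightarrow> bool" where
  "commutative \<sigma> \<longleftrightarrow> (\<forall>x y. hat \<sigma> (Some x) (Some y) = hat \<sigma> (Some y) (Some x))"

definition s_honest :: "pfun2 \<Rightarrow> bool" where
  "s_honest \<sigma> \<longleftrightarrow> (\<exists>p :: nat poly.
     (\<forall>x z. (\<exists>y. \<sigma> (x, y) = Some z) \<longrightarrow>
        (\<exists>y'. \<sigma> (x, y') = Some z \<and> length y' \<le> poly p (length x + length z))) \<and>
     (\<forall>y z. (\<exists>x. \<sigma> (x, y) = Some z) \<longrightarrow>
        (\<exists>x'. \<sigma> (x', y) = Some z \<and> length x' \<le> poly p (length y + length z))))"

definition invertible_first :: "(word \<times> word \<Rightarrow> word) \<Rightarrow> pfun2 \<Rightarrow> bool" where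
  "invertible_first pr \<sigma> \<longleftrightarrow> (\<exists>g \<in> FP. \<forall>x y z. \<sigma> (x, y) = Some z \<longrightarrow>
     (\<exists>y'. g (pr (x, z)) = Some y' \<and> \<sigma> (x, y') = Some z))"

definition invertible_second :: "(word \<times> word \<Rightarrow> word) \<Rightarrow> pfun2 \<Rightarrow> bool" where
  "invertible_second pr \<sigma> \<longleftrightarrow> (\<exists>g \<in> FP. \<forall>x y z. \<sigma> (x, y) = Some z \<longrightarrow>
     (\<exists>x'. g (pr (y, z)) = Some x' \<and> \<sigma> (x', y) = Some z))"

definition strongly_noninvertible :: "(word \<times> word \<Rightarrow> word) \<Rightarrow> pfun2 \<Rightarrow> bool" where
  "strongly_noninvertible pr \<sigma> \<longleftrightarrow> \<not> invertible_first pr \<sigma> \<and> \<not> invertible_second pr \<sigma>"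

definition strong :: "(word \<times> word \<Rightarrow> word) \<Rightarrow> pfun2 \<Rightarrow> bool" where
  "strong pr \<sigma> \<longleftrightarrow> \<sigma> \<in> FP_from_pairs \<and> s_honest \<sigma> \<and> strongly_noninvertible pr \<sigma>"

datatype requirement = Y | N | Star

fun meets :: "requirement \<Rightarrow> bool \<Rightarrow> bool" where
  "meets Y A \<longleftrightarrow> A"
| "meets N A \<longleftrightarrow> \<not> A"
| "meets Star A \<longleftrightarrow> True"

definition OWF ::
  "(word \<times> word \<Rightarrow> word) \<Rightarrow> requirement \<Rightarrow> requirement \<Rightarrow> requirement \<Rightarrow> requirement \<Rightarrow> pfun2 \<Rightarrow> bool"
where
  "OWF pr s t c a \<sigma> \<longleftrightarrow> one_way \<sigma> \<and>
     meets s (strong pr \<sigma>) \<and> meets t (is_total \<sigma>) \<and>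
     meets c (commutative \<sigma>) \<and> meets a (associative \<sigma>)"

end

theory Submission
  imports Defs
begin

text \<open>
  If P = NP, an s-honest polynomial-time \<open>\<sigma>\<close> is inverted with respect to its first argument by
  determining the second argument bit by bit.

  Conversely, let \<open>L\<close> be in NP but not in P. Encode an instance \<open>x\<close> as one word \<open>X x\<close> and a pair of \<open>x\<close> with
  a witness \<open>w\<close> as another word \<open>W x w\<close>, and put \<open>\<sigma>(X x, W x w) = Z x\<close> and \<open>\<sigma>(W x w, X x) = Z' x\<close>,
  all other products being a fixed word or undefined. Finding any preimage of \<open>Z x\<close>, or the factor of \<open>X x\<close>
  on either side, amounts to finding a witness for \<open>x\<close>. As \<open>Z x\<close> and \<open>Z' x\<close> are not factors
  themselves, all products of three words are trivial and \<open>\<sigma>\<close> is associative. It is commutative if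
  \<open>Z = Z'\<close>, and two additional products of constant words destroy associativity if desired.

  Polynomial-time computability is reduced to structured programs whose atomic actions are single
  machine steps: they compile to machines, and conversely a machine is a single loop of such a program
  with its state kept on an additional tape. This gives closure under composition and polynomially
  bounded loops, and the given pairing function reduces everything to functions of one word.
\<close>

section \<open>Programs for multitape machines\<close>

text \<open>Two obstacles shape the proof. A loop is polynomial only if its iterates stay short and
  its program can be run again; hence programs must leave all tapes blank except for the result, and
  loops carry an explicit bound on the size of every iterate. Moreover \<open>pr\<close> is given
  only by its properties, so codes of pairs are opened by the projections alone, and their lengths
  are related to those of the components only up to polynomials. Partial functions become total by
  coding undefined as the empty word and a value \<open>y\<close> as \<open>True # y\<close>, which
  leaves one class \<open>ptime\<close> to work with. A numerical bound enters an algorithm as a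
  word of that length, its clock. In the construction the first two letters of a word show its role:
  apart from the two constant squares, factors start with \<open>False\<close> and nontrivial
  products with \<open>True\<close>. In the total case the trivial product is \<open>[]\<close>,
  which is no factor. It has preimages of every length, but also preimages with an empty component,
  and these give both kinds of honesty.\<close>

type_synonym store = "nat \<Rightarrow> tape"

datatype prog =
    Act "(nat \<Rightarrow> nat) \<Rightarrow> nat \<Rightarrow> nat \<times> int"
  | Seq prog prog
  | Cond "(nat \<Rightarrow> nat) \<Rightarrow> bool" prog prog
  | Loop "(nat \<Rightarrow> nat) \<Rightarrow> bool" prog

abbreviation scan :: "store \<Rightarrow> nat \<Rightarrow> nat" where
  "scan s \<equiv> \<lambda>i. s i 0"

text \<open>A test costs one step because it becomes a state of its own that leaves the tapes alone;
  the count then equals the number of machine steps.\<close>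

inductive exec :: "prog \<Rightarrow> store \<Rightarrow> nat \<Rightarrow> store \<Rightarrow> bool" where
  exec_Act: "exec (Act f) s 1 (\<lambda>i. act (f (scan s) i) (s i))"
| exec_Seq: "exec c s t s' \<Longrightarrow> exec d s' u s'' \<Longrightarrow> exec (Seq c d) s (t + u) s''"
| exec_Cond_True: "b (scan s) \<Longrightarrow> exec c s t s' \<Longrightarrow> exec (Cond b c d) s (1 + t) s'"
| exec_Cond_False: "\<not> b (scan s) \<Longrightarrow> exec d s t s' \<Longrightarrow> exec (Cond b c d) s (1 + t) s'"
| exec_Loop_False: "\<not> b (scan s) \<Longrightarrow> exec (Loop b c) s 1 s"
| exec_Loop_True: "b (scan s) \<Longrightarrow> exec c s t s' \<Longrightarrow> exec (Loop b c) s' u s'' \<Longrightarrow>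
    exec (Loop b c) s (1 + (t + u)) s''"

text \<open>Stores have infinitely many tapes so that programs compose freely; a machine needs
  finitely many tapes and symbols. Rewriting the scanned symbol is always allowed, so that idle
  tapes satisfy the condition for every \<open>K\<close>.\<close>

fun prog_within :: "nat \<Rightarrow> nat \<Rightarrow> prog \<Rightarrow> bool" where
  "prog_within m K (Act f) \<longleftrightarrow> (\<forall>v i. (m \<le> i \<longrightarrow> f v i = (v i, 0)) \<and>
     (fst (f v i) < K \<or> fst (f v i) = v i) \<and> snd (f v i) \<in> {-1, 0, 1})"
| "prog_within m K (Seq c d) \<longleftrightarrow> prog_within m K c \<and> prog_within m K d"
| "prog_within m K (Cond b c d) \<longleftrightarrow> prog_within m K c \<and> prog_within m K d"
| "prog_within m K (Loop b c) \<longleftrightarrow> prog_within m K c"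

definition finitary :: "prog \<Rightarrow> bool" where
  "finitary c \<longleftrightarrow> (\<exists>m K. prog_within m K c)"

lemma prog_within_mono: "prog_within m K c \<Longrightarrow> m \<le> m' \<Longrightarrow> K \<le> K' \<Longrightarrow> prog_within m' K' c"
  by (induction c) (simp, meson order.strict_trans2 order.trans, auto)

lemma finitary_join:
  assumes "finitary c" "finitary d"
  obtains m K where "prog_within m K c" "prog_within m K d"
proof -
  obtain m K m' K' where "prog_within m K c" "prog_within m' K' d"
    using assms unfolding finitary_def by blast
  then have "prog_within (max m m') (max K K') c" "prog_within (max m m') (max K K') d"
    by (auto elim!: prog_within_mono)
  with that show thesis by blast
qed

lemma finitary_Seq: "finitary c \<Longrightarrow> finitary d \<Longrightarrow> finitary (Seq c d)"
  by (rule finitary_join, assumption+) (auto simp: finitary_def)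

lemma finitary_Cond: "finitary c \<Longrightarrow> finitary d \<Longrightarrow> finitary (Cond b c d)"
  by (rule finitary_join, assumption+) (auto simp: finitary_def)

lemma finitary_Loop: "finitary c \<Longrightarrow> finitary (Loop b c)"
  by (auto simp: finitary_def)

lemma finitary_ActI:
  assumes "\<And>v i. m \<le> i \<Longrightarrow> f v i = (v i, 0)"
    and "\<And>v i. fst (f v i) < K \<or> fst (f v i) = v i"
    and "\<And>v i. snd (f v i) \<in> {-1, 0, 1}"
  shows "finitary (Act f)"
  unfolding finitary_def using assms by (intro exI[of _ m] exI[of _ K]) auto

lemmas finitary_intros = finitary_Seq finitary_Cond finitary_Loop

lemma act_stay [simp]: "act (tp 0, 0) tp = tp"
  by (auto simp: act_def)

text \<open>An upper bound in place of the exact time lets different branches share one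
  bound.\<close>

definition runs :: "prog \<Rightarrow> store \<Rightarrow> nat \<Rightarrow> store \<Rightarrow> bool" where
  "runs c s t s' \<longleftrightarrow> (\<exists>u\<le>t. exec c s u s')"

lemma runs_mono: "runs c s t s' \<Longrightarrow> t \<le> t' \<Longrightarrow> runs c s t' s'"
  unfolding runs_def using order_trans by blast

lemma runs_Act: "s' = (\<lambda>i. act (f (scan s) i) (s i)) \<Longrightarrow> runs (Act f) s 1 s'"
  unfolding runs_def using exec_Act by blast

lemma runs_Seq: "runs c s t s' \<Longrightarrow> runs d s' u s'' \<Longrightarrow> runs (Seq c d) s (t + u) s''"
  unfolding runs_def by (meson exec_Seq add_mono)

lemma runs_Cond:
  "runs (if b (scan s) then c else d) s t s' \<Longrightarrow> runs (Cond b c d) s (1 + t) s'"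
  unfolding runs_def by (metis exec_Cond_True exec_Cond_False add_le_cancel_left)

lemma runs_Loop_False: "\<not> b (scan s) \<Longrightarrow> runs (Loop b c) s 1 s"
  unfolding runs_def using exec_Loop_False by blast

lemma runs_Loop_True:
  "b (scan s) \<Longrightarrow> runs c s t s' \<Longrightarrow> runs (Loop b c) s' u s'' \<Longrightarrow> runs (Loop b c) s (1 + (t + u)) s''"
  unfolding runs_def by (metis exec_Loop_True add_le_mono order_refl)

text \<open>\<open>code c e x q v\<close>: the transition in state \<open>q\<close> of \<open>c\<close>, laid out in the states from the entry
  \<open>e\<close> on and leaving to the exit \<open>x\<close>.\<close>

fun code_size :: "prog \<Rightarrow> nat" where
  "code_size (Act f) = 1"
| "code_size (Seq c d) = code_size c + code_size d"
| "code_size (Cond b c d) = 1 + code_size c + code_size d"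
| "code_size (Loop b c) = 1 + code_size c"

fun code :: "prog \<Rightarrow> nat \<Rightarrow> nat \<Rightarrow> nat \<Rightarrow> (nat \<Rightarrow> nat) \<Rightarrow> nat \<times> (nat \<Rightarrow> nat \<times> int)" where
  "code (Act f) e x q v = (x, f v)"
| "code (Seq c d) e x q v =
     (if q < e + code_size c then code c e (e + code_size c) q v
      else code d (e + code_size c) x q v)"
| "code (Cond b c d) e x q v =
     (if q = e then (if b v then e + 1 else e + 1 + code_size c, \<lambda>i. (v i, 0))
      else if q < e + 1 + code_size c then code c (e + 1) x q v
      else code d (e + 1 + code_size c) x q v)"
| "code (Loop b c) e x q v =
     (if q = e then (if b v then e + 1 else x, \<lambda>i. (v i, 0)) else code c (e + 1) e q v)"

lemma code_size_pos [simp]: "0 < code_size c"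
  by (induction c) auto

text \<open>A machine on infinitely many tapes: compilation is verified at this level, before tapes
  and symbols are cut down to finitely many.\<close>

definition store_step ::
  "(nat \<Rightarrow> (nat \<Rightarrow> nat) \<Rightarrow> nat \<times> (nat \<Rightarrow> nat \<times> int)) \<Rightarrow> nat \<times> store \<Rightarrow> nat \<times> store" where
  "store_step D = (\<lambda>(q, s). (fst (D q (scan s)), \<lambda>i. act (snd (D q (scan s)) i) (s i)))"

lemma store_step_stay: "D q (scan s) = (q', \<lambda>i. (s i 0, 0)) \<Longrightarrow> store_step D (q, s) = (q', s)"
  by (simp add: store_step_def)

text \<open>\<open>D\<close> is constrained only on the block of states of \<open>c\<close>, so one
  table serves all subprograms. The exit is generalised because it varies: for the first part of
  \<open>Seq\<close> it is the entry of the second, for a loop body the entry of the loop.\<close>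

lemma exec_code:
  assumes "exec c s t s'"
    and "\<And>q v. e \<le> q \<Longrightarrow> q < e + code_size c \<Longrightarrow> D q v = code c e x q v"
  shows "(store_step D ^^ t) (e, s) = (x, s')"
  using assms
proof (induction arbitrary: e x rule: exec.induct)
  case (exec_Act f s)
  then show ?case by (simp add: store_step_def)
next
  case (exec_Seq c s t s' d u s'')
  have "(store_step D ^^ t) (e, s) = (e + code_size c, s')"
    by (rule exec_Seq.IH(1)) (auto simp: exec_Seq.prems)
  moreover have "(store_step D ^^ u) (e + code_size c, s') = (x, s'')"
    by (rule exec_Seq.IH(2)) (auto simp: exec_Seq.prems)
  moreover have "store_step D ^^ (t + u) = store_step D ^^ u \<circ> store_step D ^^ t"
    by (metis add.commute funpow_add)
  ultimately show ?case by simp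
next
  case (exec_Cond_True b s c t s' d)
  have "(store_step D ^^ t) (e + 1, s) = (x, s')"
    by (rule exec_Cond_True.IH) (auto simp: exec_Cond_True.prems)
  moreover have "store_step D (e, s) = (e + 1, s)"
    by (rule store_step_stay) (use exec_Cond_True in auto)
  ultimately show ?case by (simp add: funpow_swap1)
next
  case (exec_Cond_False b s d t s' c)
  have "(store_step D ^^ t) (e + 1 + code_size c, s) = (x, s')"
    by (rule exec_Cond_False.IH) (auto simp: exec_Cond_False.prems)
  moreover have "store_step D (e, s) = (e + 1 + code_size c, s)"
    by (rule store_step_stay) (use exec_Cond_False in auto)
  ultimately show ?case by (simp add: funpow_swap1)
next
  case (exec_Loop_False b s c)
  have "store_step D (e, s) = (x, s)"
    by (rule store_step_stay) (use exec_Loop_False in auto)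
  then show ?case by simp
next
  case (exec_Loop_True b s c t s' u s'')
  have "(store_step D ^^ t) (e + 1, s) = (e, s')"
    by (rule exec_Loop_True.IH(1)) (auto simp: exec_Loop_True.prems)
  moreover have "(store_step D ^^ u) (e, s') = (x, s'')"
    by (rule exec_Loop_True.IH(2)) (auto simp: exec_Loop_True.prems)
  moreover have "store_step D (e, s) = (e + 1, s)"
    by (rule store_step_stay) (use exec_Loop_True in auto)
  moreover have "store_step D ^^ (1 + (t + u)) = store_step D ^^ u \<circ> store_step D ^^ t \<circ> store_step D"
    by (metis add.commute funpow_Suc_right funpow_add plus_1_eq_Suc)
  ultimately show ?case by simp
qed

lemma code_target:
  "e \<le> q \<Longrightarrow> q < e + code_size c \<Longrightarrow>
     fst (code c e x q v) = x \<or> (e \<le> fst (code c e x q v) \<and> fst (code c e x q v) < e + code_size c)"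
proof (induction c arbitrary: e x)
  case (Seq c d)
  show ?case
    using Seq.prems Seq.IH(1)[of e "e + code_size c"] Seq.IH(2)[of "e + code_size c" x] by auto
next
  case (Cond b c d)
  show ?case
    using Cond.prems Cond.IH(1)[of "e + 1" x] Cond.IH(2)[of "e + 1 + code_size c" x] by auto
next
  case (Loop b c)
  show ?case using Loop.prems Loop.IH[of "e + 1" e] by auto
qed auto

lemma code_within:
  "prog_within m K c \<Longrightarrow> e \<le> q \<Longrightarrow> q < e + code_size c \<Longrightarrow>
     prog_within m K (Act (\<lambda>v. snd (code c e x q v)))"
proof (induction c arbitrary: e x)
  case (Seq c d)
  then show ?case
    using Seq.IH(1)[of e "e + code_size c"] Seq.IH(2)[of "e + code_size c" x] by auto
next
  case (Cond b c d)
  then show ?case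
    using Cond.IH(1)[of "e + 1" x] Cond.IH(2)[of "e + 1 + code_size c" x] by auto
next
  case (Loop b c)
  then show ?case using Loop.IH[of "e + 1" e] by auto
qed auto

text \<open>States \<open>0\<close> and \<open>1\<close> accept and reject. After \<open>c\<close>, the machine rejects if the word on the first
  tape is empty, and otherwise accepts after deleting the first letter.\<close>

definition machine_code :: "prog \<Rightarrow> nat \<Rightarrow> (nat \<Rightarrow> nat) \<Rightarrow> nat \<times> (nat \<Rightarrow> nat \<times> int)" where
  "machine_code c q v =
     (if q < 2 then (q, \<lambda>i. (v i, 0))
      else if q < 2 + code_size c then code c 2 (2 + code_size c) q v
      else (if v 0 = 0 then 1 else 0, \<lambda>i. (v i, if i = 0 then 1 else 0)))"

text \<open>Besides the code there are three states: the two halting ones and the final test at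
  \<open>2 + code_size c\<close>. Tapes from \<open>m\<close> on are read as blank, as they are in
  the stores to which \<open>step_machine\<close> applies.\<close>

definition machine :: "nat \<Rightarrow> nat \<Rightarrow> prog \<Rightarrow> tm" where
  "machine m K c = \<lparr>states = code_size c + 3, tapes = m, symbols = K, start = 2, accept = 0,
     reject = 1, delta = (\<lambda>q as. let r = machine_code c q (\<lambda>j. if j < m then as ! j else 0)
       in (fst r, map (snd r) [0..<m]))\<rparr>"

lemma machine_code_within:
  assumes "prog_within m K c" "0 < m"
  shows "prog_within m K (Act (\<lambda>v. snd (machine_code c q v)))"
proof (cases "q < 2 \<or> q \<ge> 2 + code_size c")
  case True
  then show ?thesis using assms(2) by (auto simp: machine_code_def)
next
  case False
  then have "(\<lambda>v. snd (machine_code c q v)) = (\<lambda>v. snd (code c 2 (2 + code_size c) q v))"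
    by (auto simp: machine_code_def)
  with False code_within[OF assms(1), of 2 q "2 + code_size c"] show ?thesis by simp
qed

lemma machine_code_target:
  "q < code_size c + 3 \<Longrightarrow> fst (machine_code c q v) < code_size c + 3"
  using code_target[of 2 q c "2 + code_size c" v] by (auto simp: machine_code_def)

lemma wf_machine:
  assumes "prog_within m K c" "0 < m" "3 \<le> K"
  shows "wf_tm (machine m K c)"
proof -
  have "set (map (snd (machine_code c q (\<lambda>j. if j < m then as ! j else 0))) [0..<m])
      \<subseteq> {..<K} \<times> {-1, 0, 1}" if "length as = m" "set as \<subseteq> {..<K}" for q as
  proof -
    define v where "v = (\<lambda>j. if j < m then as ! j else 0)"
    have "v j < K" for j
      using that assms(3) by (auto simp: v_def subset_iff)
    with machine_code_within[OF assms(1,2), of q] have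
      "fst (snd (machine_code c q v) i) < K \<and> snd (snd (machine_code c q v) i) \<in> {-1, 0, 1}" for i
      unfolding prog_within.simps by metis
    then show ?thesis
      unfolding v_def[symmetric] set_map by (intro image_subsetI) (simp add: mem_Times_iff)
  qed
  with machine_code_target[of _ c] assms(3) show ?thesis
    unfolding wf_tm_def machine_def by (simp add: Let_def)
qed

lemma step_machine:
  assumes "prog_within m K c" "0 < m" "\<forall>i\<ge>m. s i = inscription []"
    and "store_step (machine_code c) (q, s) = (q', s')"
  shows "step (machine m K c) (q, map s [0..<m]) = (q', map s' [0..<m]) \<and>
    (\<forall>i\<ge>m. s' i = inscription [])"
proof -
  have v: "(\<lambda>j. if j < m then map (\<lambda>tp. tp 0) (map s [0..<m]) ! j else 0) = scan s"
    using assms(3) by (auto simp: inscription_def)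
  have q': "q' = fst (machine_code c q (scan s))"
    and s': "s' = (\<lambda>i. act (snd (machine_code c q (scan s)) i) (s i))"
    using assms(4) by (auto simp: store_step_def)
  have "s' i = inscription []" if "i \<ge> m" for i
    using machine_code_within[OF assms(1,2), of q] that assms(3) unfolding s' by simp
  moreover have "step (machine m K c) (q, map s [0..<m]) = (q', map s' [0..<m])"
  proof (cases "q < 2")
    case True
    then have "q = 0 \<or> q = 1" by auto
    moreover have "q' = q" "s' = s" using True unfolding q' s' by (auto simp: machine_code_def)
    ultimately show ?thesis by (auto simp: step_def machine_def)
  next
    case False
    have "map2 act (map (snd (machine_code c q (scan s))) [0..<m]) (map s [0..<m]) = map s' [0..<m]"
      by (simp add: s' list_eq_iff_nth_eq)
    with False v show ?thesis
      unfolding step_def machine_def by (auto simp: Let_def q')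
  qed
  ultimately show ?thesis by blast
qed

lemma steps_machine:
  assumes "prog_within m K c" "0 < m" "\<forall>i\<ge>m. s i = inscription []"
    and "(store_step (machine_code c) ^^ t) (q, s) = (q', s')"
  shows "(step (machine m K c) ^^ t) (q, map s [0..<m]) = (q', map s' [0..<m])"
  using assms(3,4)
proof (induction t arbitrary: q s)
  case (Suc t)
  obtain q1 s1 where 1: "store_step (machine_code c) (q, s) = (q1, s1)" by force
  then have "(store_step (machine_code c) ^^ t) (q1, s1) = (q', s')"
    using Suc.prems(2) by (simp add: funpow_swap1)
  with step_machine[OF assms(1,2) Suc.prems(1) 1] Suc.IH[of s1 q1] show ?case
    by (simp add: funpow_swap1)
qed simp

text \<open>The program may stop early, but halting configurations are fixed points, so the result
  is still there after exactly \<open>t + 1\<close> steps. The last step moves the head of tape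
  \<open>0\<close> past the first letter; since a word begins at the head, this deletes the
  letter.\<close>

lemma machine_run:
  assumes "prog_within m K c" "0 < m" "\<forall>i\<ge>m. s i = inscription []" "runs c s t s'"
  shows "(step (machine m K c) ^^ (t + 1)) (2, map s [0..<m]) =
    (if s' 0 0 = 0 then 1 else 0,
     map (s'(0 := act (s' 0 0, 1) (s' 0))) [0..<m])"
proof -
  let ?S = "store_step (machine_code c)"
  let ?r = "(if s' 0 0 = 0 then 1 else 0 :: nat, s'(0 := act (s' 0 0, 1) (s' 0)))"
  obtain u where u: "u \<le> t" "exec c s u s'" using assms(4) by (auto simp: runs_def)
  have "(?S ^^ u) (2, s) = (2 + code_size c, s')"
    by (rule exec_code[OF u(2)]) (auto simp: machine_code_def)
  moreover have "?S (2 + code_size c, s') = ?r"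
    by (auto simp: store_step_def machine_code_def)
  moreover have "(?S ^^ n) ?r = ?r" for n
  proof (induction n)
    case (Suc n)
    have "?S ?r = ?r" unfolding store_step_def machine_code_def by auto
    then show ?case unfolding funpow.simps o_apply Suc .
  qed simp
  moreover have "t + 1 = (t - u) + (1 + u)" using u(1) by simp
  then have "?S ^^ (t + 1) = ?S ^^ (t - u) \<circ> (?S \<circ> ?S ^^ u)"
    by (metis funpow_add funpow.simps(2) plus_1_eq_Suc)
  ultimately have "(?S ^^ (t + 1)) (2, s) = ?r" by (simp del: fun_upd_apply split del: if_split)
  then show ?thesis by (rule steps_machine[OF assms(1-3)])
qed

section \<open>Words on tapes\<close>

definition inscribe :: "(nat \<Rightarrow> word) \<Rightarrow> store" where
  "inscribe st = (\<lambda>i. inscription (st i))"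

lemma letter_less [simp]: "letter b < 3" and letter_neq_0 [simp]: "letter b \<noteq> 0"
  by (auto simp: letter_def)

lemma inscription_Nil_0 [simp]: "inscription [] i = 0"
  and inscription_Cons_0 [simp]: "inscription (b # w) 0 = letter b"
  by (auto simp: inscription_def)

lemma scan_inscribe: "inscribe st i 0 = (case st i of [] \<Rightarrow> 0 | b # w \<Rightarrow> letter b)"
  by (auto simp: inscribe_def split: list.split)

lemma scan_inscribe_0 [simp]: "inscribe st i 0 = 0 \<longleftrightarrow> st i = []"
  by (simp add: scan_inscribe split: list.split)

lemma act_pop: "act (0, 1) (inscription (b # w)) = inscription w"
proof
  fix i :: int
  show "act (0, 1) (inscription (b # w)) i = inscription w i"
    by (cases "0 \<le> i") (auto simp: act_def inscription_def nat_add_distrib)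
qed

text \<open>A machine step writes before it moves, so prepending a letter takes a move to the left
  followed by a separate writing step.\<close>

lemma act_push: "act (letter b, 0) (act (inscription w 0, -1) (inscription w)) = inscription (b # w)"
proof
  fix i :: int
  show "act (letter b, 0) (act (inscription w 0, -1) (inscription w)) i = inscription (b # w) i"
    by (cases "0 < i") (auto simp: act_def inscription_def nth_Cons' nat_diff_distrib)
qed

text \<open>The minimum bounds the symbols written, as \<open>finitary\<close> demands; letters are at most \<open>2\<close>.\<close>

definition move_word :: "nat \<Rightarrow> nat set \<Rightarrow> prog" where
  "move_word a B = Loop (\<lambda>v. v a \<noteq> 0)
     (Seq (Act (\<lambda>v i. (v i, if i \<in> B then -1 else 0)))
          (Act (\<lambda>v i. if i = a then (0, 1) else if i \<in> B then (min (v a) 2, 0) else (v i, 0))))"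

definition push :: "nat \<Rightarrow> bool \<Rightarrow> prog" where
  "push a b = Seq (Act (\<lambda>v i. (v i, if i = a then -1 else 0)))
     (Act (\<lambda>v i. (if i = a then letter b else v i, 0)))"

definition pop :: "nat \<Rightarrow> prog" where
  "pop a = Act (\<lambda>v i. if i = a \<and> v a \<noteq> 0 then (0, 1) else (v i, 0))"

lemma runs_push: "runs (push a b) (inscribe st) 2 (inscribe (st(a := b # st a)))"
proof -
  have "runs (push a b) (inscribe st) (1 + 1) (inscribe (st(a := b # st a)))"
    unfolding push_def
    by (rule runs_Seq, rule runs_Act, rule refl, rule runs_Act) (auto simp: inscribe_def act_push)
  then show ?thesis by (simp only: one_add_one)
qed

lemma runs_pop: "runs (pop a) (inscribe st) 1 (inscribe (st(a := tl (st a))))"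
  unfolding pop_def
proof (rule runs_Act, rule ext)
  fix i
  show "inscribe (st(a := tl (st a))) i =
    act (if i = a \<and> inscribe st a 0 \<noteq> 0 then (0, 1) else (inscribe st i 0, 0)) (inscribe st i)"
  proof (cases "i = a \<and> st a \<noteq> []")
    case True
    then obtain b w where "st a = b # w" by (cases "st a") auto
    with True show ?thesis by (simp add: inscribe_def act_pop)
  next
    case False
    then show ?thesis by (auto simp: inscribe_def)
  qed
qed

text \<open>Letters are popped from \<open>a\<close> and pushed on each tape of \<open>B\<close>,
  hence the reversal; each letter costs a test and two actions. With \<open>B\<close> empty this
  erases a word, and two transfers through an auxiliary tape copy it.\<close>

lemma runs_move_word:
  assumes "a \<notin> B"
  shows "runs (move_word a B) (inscribe st) (1 + 3 * length (st a))
    (inscribe (\<lambda>i. if i = a then [] else if i \<in> B then rev (st a) @ st i else st i))"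
proof (induction "st a" arbitrary: st)
  case Nil
  then have "(\<lambda>i. if i = a then [] else if i \<in> B then rev (st a) @ st i else st i) = st"
    by auto
  then show ?case using Nil unfolding move_word_def by (auto intro: runs_mono[OF runs_Loop_False])
next
  case (Cons b w)
  define st' where "st' = (\<lambda>i. if i = a then w else if i \<in> B then b # st i else st i)"
  let ?s = "\<lambda>i. act (inscribe st i 0, if i \<in> B then -1 else 0) (inscribe st i)"
  have a: "?s a 0 = letter b"
    using Cons(2)[symmetric] assms by (simp add: scan_inscribe act_def inscribe_def)
  have min: "min (letter b) 2 = letter b" by (simp add: letter_def)
  have step: "runs (Seq (Act (\<lambda>v i. (v i, if i \<in> B then -1 else 0)))
          (Act (\<lambda>v i. if i = a then (0, 1) else if i \<in> B then (min (v a) 2, 0) else (v i, 0))))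
      (inscribe st) (1 + 1) (inscribe st')"
  proof (rule runs_Seq, rule runs_Act, rule refl, rule runs_Act, rule ext)
    fix i
    show "inscribe st' i = act (if i = a then (0, 1) else if i \<in> B then (min (?s a 0) 2, 0)
        else (?s i 0, 0)) (?s i)"
      unfolding a min using assms Cons(2)[symmetric]
      by (auto simp: st'_def inscribe_def act_pop act_push
          act_stay[of "inscription (b # w)", simplified])
  qed
  have w: "w = st' a" by (simp add: st'_def)
  have "(\<lambda>i. if i = a then [] else if i \<in> B then rev (st' a) @ st' i else st' i) =
      (\<lambda>i. if i = a then [] else if i \<in> B then rev (st a) @ st i else st i)"
    using assms Cons(2)[symmetric] by (auto simp: st'_def)
  with Cons(1)[of st', OF w] have "runs (move_word a B) (inscribe st') (1 + 3 * length w)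
      (inscribe (\<lambda>i. if i = a then [] else if i \<in> B then rev (st a) @ st i else st i))"
    by (simp add: w)
  then have "runs (move_word a B) (inscribe st) (1 + ((1 + 1) + (1 + 3 * length w)))
      (inscribe (\<lambda>i. if i = a then [] else if i \<in> B then rev (st a) @ st i else st i))"
    unfolding move_word_def using Cons(2)[symmetric]
    by (intro runs_Loop_True[OF _ step]) auto
  then show ?case by (rule runs_mono) (simp add: Cons(2)[symmetric])
qed

lemma finitary_move_word [simp]: "finite B \<Longrightarrow> finitary (move_word a B)"
proof -
  assume "finite B"
  then obtain n where n: "\<And>i. i \<in> B \<Longrightarrow> i < n"
    using finite_nat_set_iff_bounded by auto
  have 1: "finitary (Act (\<lambda>v i. (v i, if i \<in> B then -1 else 0)))"
    by (rule finitary_ActI[of n _ 0]) (auto dest: n)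
  have 2: "finitary (Act (\<lambda>v i. if i = a then (0, 1) else if i \<in> B then (min (v a) 2, 0) else (v i, 0)))"
    by (rule finitary_ActI[of "max n (Suc a)" _ 3]) (auto dest: n)
  from 1 2 show ?thesis unfolding move_word_def by (intro finitary_intros)
qed

lemma finitary_push [simp]: "finitary (push a b)"
proof -
  have 1: "finitary (Act (\<lambda>v i. (v i, if i = a then -1 else 0)))"
    by (rule finitary_ActI[of "Suc a" _ 0]) auto
  have 2: "finitary (Act (\<lambda>v i. (if i = a then letter b else v i, 0)))"
    by (rule finitary_ActI[of "Suc a" _ 3]) auto
  from 1 2 show ?thesis unfolding push_def by (intro finitary_intros)
qed

lemma finitary_pop [simp]: "finitary (pop a)"
  unfolding pop_def by (rule finitary_ActI[of "Suc a" _ 1]) auto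

section \<open>Renaming of tapes\<close>

fun rename :: "(nat \<Rightarrow> nat) \<Rightarrow> prog \<Rightarrow> prog" where
  "rename r (Act f) = Act (\<lambda>v i. if i \<in> range r then f (v \<circ> r) (inv r i) else (v i, 0))"
| "rename r (Seq c d) = Seq (rename r c) (rename r d)"
| "rename r (Cond b c d) = Cond (\<lambda>v. b (v \<circ> r)) (rename r c) (rename r d)"
| "rename r (Loop b c) = Loop (\<lambda>v. b (v \<circ> r)) (rename r c)"

text \<open>Lets a program written for tape \<open>0\<close> and its own work tapes run while
  another word is kept aside; injectivity of \<open>r\<close> keeps its tapes distinct.\<close>

lemma exec_rename:
  assumes "inj r" "exec c s t s'" "S \<circ> r = s"
  shows "exec (rename r c) S t (\<lambda>i. if i \<in> range r then s' (inv r i) else S i)"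
  using assms(2,3)
proof (induction arbitrary: S rule: exec.induct)
  case (exec_Act f s)
  have s: "s = (\<lambda>i. S (r i))" using exec_Act by auto
  have "(\<lambda>i. if i \<in> range r then act (f (scan s) (inv r i)) (s (inv r i)) else S i) =
    (\<lambda>i. act (if i \<in> range r then f (scan S \<circ> r) (inv r i) else (S i 0, 0)) (S i))"
    unfolding s by (rule ext) (auto simp: comp_def inv_f_f[OF assms(1)])
  then show ?case using exec.exec_Act[of _ S] by simp
next
  case (exec_Seq c s t s' d u s'')
  let ?S = "\<lambda>i. if i \<in> range r then s' (inv r i) else S i"
  have "?S \<circ> r = s'" by (auto simp: inv_f_f[OF assms(1)])
  from exec.exec_Seq[OF exec_Seq.IH(1)[OF exec_Seq.prems] exec_Seq.IH(2)[OF this]]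
  show ?case by (simp cong: if_cong)
next
  case (exec_Loop_False b s c)
  have "(\<lambda>i. if i \<in> range r then s (inv r i) else S i) = S"
    using exec_Loop_False by (intro ext) (auto simp: inv_f_f[OF assms(1)])
  then show ?case using exec.exec_Loop_False[of _ S] exec_Loop_False by (auto simp: comp_def)
next
  case (exec_Loop_True b s c t s' u s'')
  let ?S = "\<lambda>i. if i \<in> range r then s' (inv r i) else S i"
  have S: "?S \<circ> r = s'" by (auto simp: inv_f_f[OF assms(1)])
  have b: "b (scan S \<circ> r)" using exec_Loop_True.hyps(1) exec_Loop_True.prems by (auto simp: comp_def)
  show ?case
    using exec.exec_Loop_True[where b = "\<lambda>v. b (v \<circ> r)", OF b exec_Loop_True.IH(1)[OF exec_Loop_True.prems]
        exec_Loop_True.IH(2)[OF S, unfolded rename.simps]]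
    by (simp cong: if_cong)
next
  case (exec_Cond_True b s c t s' d)
  then show ?case
    using exec.exec_Cond_True[where b = "\<lambda>v. b (v \<circ> r)", of S] by (auto simp: comp_def)
next
  case (exec_Cond_False b s d t s' c)
  then show ?case
    using exec.exec_Cond_False[where b = "\<lambda>v. b (v \<circ> r)", of S] by (auto simp: comp_def)
qed

lemma finitary_rename:
  assumes "inj r" "finitary c"
  shows "finitary (rename r c)"
proof -
  obtain m K where mK: "prog_within m K c" using assms(2) by (auto simp: finitary_def)
  have "\<exists>n. \<forall>i<m. r i < n"
    using finite_nat_set_iff_bounded[of "r ` {..<m}"] by auto
  then obtain n where n: "\<forall>i<m. r i < n" by blast
  have "prog_within n K (rename r c)"
    using mK
  proof (induction c)
    case (Act f)
    have "m \<le> i" if "n \<le> r i" for i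
      using n that by (meson leD leI)
    with Act show ?case
      by (auto simp: inv_f_f[OF assms(1)]) (metis comp_apply)+
  qed auto
  then show ?thesis by (auto simp: finitary_def)
qed

section \<open>Polynomial bounds\<close>

definition polyfun :: "(nat \<Rightarrow> nat) \<Rightarrow> bool" where
  "polyfun g \<longleftrightarrow> (\<exists>p. g = poly p)"

lemma polyfun_const [intro, simp]: "polyfun (\<lambda>_. c)"
  unfolding polyfun_def by (rule exI[of _ "[:c:]"]) auto

lemma polyfun_id [intro, simp]: "polyfun (\<lambda>n. n)"
  unfolding polyfun_def by (rule exI[of _ "[:0, 1:]"]) auto

lemma polyfun_add [intro]: "polyfun g \<Longrightarrow> polyfun h \<Longrightarrow> polyfun (\<lambda>n. g n + h n)"
  unfolding polyfun_def
proof (elim exE)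
  fix p q
  assume "g = poly p" "h = poly q"
  then show "\<exists>r. (\<lambda>n. g n + h n) = poly r" by (intro exI[of _ "p + q"]) (auto simp: poly_pcompose)
qed

lemma polyfun_mult [intro]: "polyfun g \<Longrightarrow> polyfun h \<Longrightarrow> polyfun (\<lambda>n. g n * h n)"
  unfolding polyfun_def
proof (elim exE)
  fix p q
  assume "g = poly p" "h = poly q"
  then show "\<exists>r. (\<lambda>n. g n * h n) = poly r" by (intro exI[of _ "p * q"]) (auto simp: poly_pcompose)
qed

lemma polyfun_comp [intro]: "polyfun g \<Longrightarrow> polyfun h \<Longrightarrow> polyfun (\<lambda>n. g (h n))"
  unfolding polyfun_def
proof (elim exE)
  fix p q
  assume "g = poly p" "h = poly q"
  then show "\<exists>r. (\<lambda>n. g (h n)) = poly r" by (intro exI[of _ "pcompose p q"]) (auto simp: poly_pcompose)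
qed

lemma polyfun_poly [intro, simp]: "polyfun (poly p)"
  unfolding polyfun_def by blast

text \<open>Coefficients are natural numbers, so no term decreases. This turns a bound in the length
  of an intermediate result into one in the length of the input.\<close>

lemma polyfun_mono: "polyfun g \<Longrightarrow> m \<le> n \<Longrightarrow> g m \<le> g n"
proof -
  have "poly p m \<le> poly p n" if "m \<le> n" for p :: "nat poly"
    using that by (induction p) (auto intro: add_mono mult_mono)
  then show "polyfun g \<Longrightarrow> m \<le> n \<Longrightarrow> g m \<le> g n" by (auto simp: polyfun_def)
qed

section \<open>Words computable in polynomial time\<close>

lemma polyfun_Suc [intro]: "polyfun g \<Longrightarrow> polyfun (\<lambda>n. Suc (g n))"
  using polyfun_add[of g "\<lambda>_. 1"] by simp

definition inputs :: "word list \<Rightarrow> store" where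
  "inputs xs = inscribe (\<lambda>i. if i < length xs then xs ! i else [])"

definition total_length :: "word list \<Rightarrow> nat" where
  "total_length xs = sum_list (map length xs)"

text \<open>The final store is blank apart from the result, so that the program can be followed by
  another or repeated. The bound on the output length is what the time bound of a subsequent program
  is applied to.\<close>

definition ptimes :: "nat \<Rightarrow> (word list \<Rightarrow> word) \<Rightarrow> bool" where
  "ptimes k F \<longleftrightarrow> (\<exists>c B. finitary c \<and> polyfun B \<and>
     (\<forall>xs. length xs = k \<longrightarrow> length (F xs) \<le> B (total_length xs) \<and>
        runs c (inputs xs) (B (total_length xs)) (inputs [F xs])))"

definition ptime :: "(word \<Rightarrow> word) \<Rightarrow> bool" where
  "ptime f \<longleftrightarrow> (\<exists>c B. finitary c \<and> polyfun B \<and>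
     (\<forall>x. length (f x) \<le> B (length x) \<and> runs c (inputs [x]) (B (length x)) (inputs [f x])))"

lemma ptimesI:
  assumes "finitary c" "polyfun B" "polyfun B'"
    and "\<And>xs. length xs = k \<Longrightarrow> length (F xs) \<le> B (total_length xs)"
    and "\<And>xs. length xs = k \<Longrightarrow> runs c (inputs xs) (B' (total_length xs)) (inputs [F xs])"
  shows "ptimes k F"
  unfolding ptimes_def using assms
  by (intro exI[of _ c] exI[of _ "\<lambda>n. B n + B' n"])
    (auto intro: trans_le_add1 runs_mono[OF _ le_add2])

lemma ptimeI:
  assumes "finitary c" "polyfun B" "polyfun B'"
    and "\<And>x. length (f x) \<le> B (length x)"
    and "\<And>x. runs c (inputs [x]) (B' (length x)) (inputs [f x])"
  shows "ptime f"
  unfolding ptime_def using assms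
  by (intro exI[of _ c] exI[of _ "\<lambda>n. B n + B' n"])
    (auto intro: trans_le_add1 runs_mono[OF _ le_add2])

lemma ptimes_1: "ptimes 1 (\<lambda>xs. f (xs ! 0)) \<longleftrightarrow> ptime f"
proof -
  have "(\<forall>xs. length xs = 1 \<longrightarrow> P xs) \<longleftrightarrow> (\<forall>x. P [x])" for P :: "word list \<Rightarrow> bool"
    by (auto simp: length_Suc_conv)
  then show ?thesis unfolding ptimes_def ptime_def total_length_def by simp
qed

lemma ptime_length:
  assumes "ptime f"
  obtains B where "polyfun B" "\<And>x. length (f x) \<le> B (length x)"
  using assms unfolding ptime_def by blast

lemma inscribe_inputs: "(\<And>i. st i = (if i < length xs then xs ! i else [])) \<Longrightarrow> inscribe st = inputs xs"
  unfolding inputs_def by presburger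

section \<open>Composition, branching and iteration\<close>

lemma ptimes_comp:
  assumes "ptime f" "ptimes k G"
  shows "ptimes k (\<lambda>xs. f (G xs))"
proof -
  obtain c B where c: "finitary c" "polyfun B" "\<And>x. length (f x) \<le> B (length x)"
    "\<And>x. runs c (inputs [x]) (B (length x)) (inputs [f x])"
    using assms(1) by (auto simp: ptime_def)
  obtain d D where d: "finitary d" "polyfun D"
    "\<And>xs. length xs = k \<Longrightarrow> length (G xs) \<le> D (total_length xs)"
    "\<And>xs. length xs = k \<Longrightarrow> runs d (inputs xs) (D (total_length xs)) (inputs [G xs])"
    using assms(2) by (auto simp: ptimes_def)
  show ?thesis
  proof (rule ptimesI[where c = "Seq d c" and B = "\<lambda>n. B (D n)" and B' = "\<lambda>n. D n + B (D n)"])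
    fix xs :: "word list"
    assume xs: "length xs = k"
    have le: "B (length (G xs)) \<le> B (D (total_length xs))"
      by (rule polyfun_mono[OF c(2) d(3)[OF xs]])
    show "length (f (G xs)) \<le> B (D (total_length xs))"
      using c(3) le by (rule order_trans)
    show "runs (Seq d c) (inputs xs) (D (total_length xs) + B (D (total_length xs))) (inputs [f (G xs)])"
      using d(4)[OF xs] runs_mono[OF c(4) le] by (rule runs_Seq)
  qed (use c d in \<open>auto intro: finitary_Seq\<close>)
qed

lemma ptime_comp: "ptime f \<Longrightarrow> ptime g \<Longrightarrow> ptime (\<lambda>x. f (g x))"
  using ptimes_comp[of f 1 "\<lambda>xs. g (xs ! 0)"] ptimes_1[of g] ptimes_1[of "\<lambda>x. f (g x)"] by simp

text \<open>Places tape \<open>0\<close> of a program on tape \<open>a\<close> and shifts its other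
  tapes up by one; of the tapes \<open>0\<close> and \<open>1\<close>, the one other than
  \<open>a\<close> is then free to keep a second word.\<close>

definition beside :: "nat \<Rightarrow> nat \<Rightarrow> nat" where
  "beside a i = (if i = 0 then a else Suc i)"

lemma inj_beside: "a \<le> 1 \<Longrightarrow> inj (beside a)"
  by (auto simp: inj_def beside_def)

lemma runs_rename:
  assumes "inj r" "runs c (S \<circ> r) t s'"
  shows "runs (rename r c) S t (\<lambda>i. if i \<in> range r then s' (inv r i) else S i)"
  using assms exec_rename[OF assms(1) _ refl] unfolding runs_def by blast

lemma runs_beside:
  assumes "runs c (inputs [x]) t (inputs [y])" "a \<le> 1" "st a = x" "\<And>i. 2 \<le> i \<Longrightarrow> st i = []"
  shows "runs (rename (beside a) c) (inscribe st) t (inscribe (st(a := y)))"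
proof -
  note inj = inj_beside[OF assms(2)]
  have "inscribe st \<circ> beside a = inputs [x]"
    using assms(3,4) unfolding inputs_def inscribe_def by (auto simp: beside_def)
  with runs_rename[OF inj, of c "inscribe st" t "inputs [y]"] assms(1)
  have "runs (rename (beside a) c) (inscribe st) t
      (\<lambda>i. if i \<in> range (beside a) then inputs [y] (inv (beside a) i) else inscribe st i)"
    by simp
  moreover have "(if i \<in> range (beside a) then inputs [y] (inv (beside a) i) else inscribe st i) =
      inscribe (st(a := y)) i" for i
  proof (cases "i \<in> range (beside a)")
    case True
    then obtain j where j: "i = beside a j" by blast
    with inj assms(2,4) show ?thesis
      by (auto simp: inv_f_f inputs_def inscribe_def) (auto simp: beside_def split: if_splits)
  next
    case False
    then have "i \<noteq> a" by (metis beside_def rangeI)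
    with False show ?thesis by (simp add: inscribe_def)
  qed
  ultimately show ?thesis by simp
qed

lemma runs_first:
  assumes "runs c (inputs [x]) t (inputs [x'])"
  shows "runs (rename (beside 0) c) (inputs [x, y]) t (inputs [x', y])"
proof -
  have "inputs [x', y] = inscribe ((\<lambda>i. if i < length [x, y] then [x, y] ! i else [])(0 := x'))"
    unfolding inputs_def by (rule arg_cong[of _ _ inscribe]) (auto simp: less_Suc_eq)
  then show ?thesis unfolding inputs_def[of "[x, y]"]
    using runs_beside[OF assms, of 0 "\<lambda>i. if i < length [x, y] then [x, y] ! i else []"] by simp
qed

lemma runs_second:
  assumes "runs c (inputs [y]) t (inputs [y'])"
  shows "runs (rename (beside 1) c) (inputs [x, y]) t (inputs [x, y'])"
proof -
  have "inputs [x, y'] = inscribe ((\<lambda>i. if i < length [x, y] then [x, y] ! i else [])(1 := y'))"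
    unfolding inputs_def by (rule arg_cong[of _ _ inscribe]) (auto simp: less_Suc_eq)
  then show ?thesis unfolding inputs_def[of "[x, y]"]
    using runs_beside[OF assms, of 1 "\<lambda>i. if i < length [x, y] then [x, y] ! i else []"] by simp
qed

lemma inputs_Nil: "inputs [x, []] = inputs [x]"
  unfolding inputs_def by (rule arg_cong[of _ _ inscribe]) (auto simp: less_Suc_eq)

lemma runs_move_word_inputs:
  assumes "a \<notin> B" "a < length xs"
    and "\<And>i. (if i < length ys then ys ! i else []) =
      (if i = a then [] else (if i \<in> B then rev (xs ! a) else []) @ (if i < length xs then xs ! i else []))"
  shows "runs (move_word a B) (inputs xs) (1 + 3 * length (xs ! a)) (inputs ys)"
proof -
  let ?st = "\<lambda>i. if i < length xs then xs ! i else []"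
  have "inscribe (\<lambda>i. if i = a then [] else if i \<in> B then rev (?st a) @ ?st i else ?st i) = inputs ys"
    by (rule inscribe_inputs) (use assms in auto)
  with runs_move_word[OF assms(1), of ?st] assms(2) show ?thesis
    unfolding inputs_def[of xs] by simp
qed

lemma runs_clear_first: "runs (move_word 0 {}) (inputs [x]) (1 + 3 * length x) (inputs [[]])"
  using runs_move_word_inputs[of 0 "{}" "[x]" "[[]]"] by simp

lemma runs_clear_second: "runs (move_word 1 {}) (inputs [x, y]) (1 + 3 * length y) (inputs [x])"
  using runs_move_word_inputs[of 1 "{}" "[x, y]" "[x]"] by (simp add: less_Suc_eq)

definition copy :: prog where
  "copy = Seq (move_word 0 {2}) (move_word 2 {0, 1})"

lemma runs_copy: "runs copy (inputs [x]) (2 + 6 * length x) (inputs [x, x])"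
proof -
  have 1: "runs (move_word 0 {2}) (inputs [x]) (1 + 3 * length ([x] ! 0)) (inputs [[], [], rev x])"
    by (rule runs_move_word_inputs) (auto simp: less_Suc_eq)
  have 2: "runs (move_word 2 {0, 1}) (inputs [[], [], rev x])
      (1 + 3 * length ([[], [], rev x] ! 2)) (inputs [x, x])"
    by (rule runs_move_word_inputs) (auto simp: less_Suc_eq)
  show ?thesis unfolding copy_def using runs_mono[OF runs_Seq[OF 1 2]] by simp
qed

lemma finitary_copy [simp]: "finitary copy"
  by (simp add: copy_def finitary_Seq)

text \<open>The argument survives on tape \<open>0\<close> while the computation consumes a copy on
  tape \<open>1\<close>.\<close>

definition test_second :: "prog \<Rightarrow> prog" where
  "test_second c = Seq copy (rename (beside 1) c)"

lemma runs_test_second: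
  assumes "runs c (inputs [x]) t (inputs [y])"
  shows "runs (test_second c) (inputs [x]) (2 + 6 * length x + t) (inputs [x, y])"
  unfolding test_second_def by (rule runs_Seq[OF runs_copy runs_second[OF assms]])

lemma finitary_test_second: "finitary c \<Longrightarrow> finitary (test_second c)"
  unfolding test_second_def by (simp add: finitary_Seq finitary_rename inj_beside)

text \<open>\<open>h\<close> consumes a copy on tape \<open>1\<close>, then \<open>g\<close> the
  original on tape \<open>0\<close>; the results lie where the two-argument program expects its
  inputs.\<close>

lemma ptime_comp2:
  assumes "ptimes 2 F" "ptime g" "ptime h"
  shows "ptime (\<lambda>x. F [g x, h x])"
proof -
  obtain c B where c: "finitary c" "polyfun B" "\<And>x. length (g x) \<le> B (length x)"
    "\<And>x. runs c (inputs [x]) (B (length x)) (inputs [g x])"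
    using assms(2) by (auto simp: ptime_def)
  obtain d D where d: "finitary d" "polyfun D" "\<And>x. length (h x) \<le> D (length x)"
    "\<And>x. runs d (inputs [x]) (D (length x)) (inputs [h x])"
    using assms(3) by (auto simp: ptime_def)
  obtain e E where e: "finitary e" "polyfun E"
    "\<And>xs. length xs = 2 \<Longrightarrow> length (F xs) \<le> E (total_length xs)"
    "\<And>xs. length xs = 2 \<Longrightarrow> runs e (inputs xs) (E (total_length xs)) (inputs [F xs])"
    using assms(1) by (auto simp: ptimes_def)
  have le: "E (total_length [g x, h x]) \<le> E (B (length x) + D (length x))" for x
    by (rule polyfun_mono[OF e(2)]) (simp add: total_length_def add_mono c(3) d(3))
  show ?thesis
  proof (rule ptimeI[where c = "Seq (test_second d) (Seq (rename (beside 0) c) e)"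
        and B = "\<lambda>n. E (B n + D n)" and B' = "\<lambda>n. (2 + 6 * n + D n) + (B n + E (B n + D n))"])
    fix x
    show "length (F [g x, h x]) \<le> E (B (length x) + D (length x))"
      using e(3)[of "[g x, h x]"] le[of x] by simp
    show "runs (Seq (test_second d) (Seq (rename (beside 0) c) e)) (inputs [x])
      ((2 + 6 * length x + D (length x)) + (B (length x) + E (B (length x) + D (length x))))
      (inputs [F [g x, h x]])"
      by (intro runs_Seq[OF runs_test_second[OF d(4)]] runs_Seq[OF runs_first[OF c(4)]]
          runs_mono[OF e(4) le]) simp
  next
    show "polyfun (\<lambda>n. (2 + 6 * n + D n) + (B n + E (B n + D n)))"
      by (intro polyfun_add polyfun_mult polyfun_const polyfun_id polyfun_comp[OF e(2)] c d)
    show "polyfun (\<lambda>n. E (B n + D n))"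
      by (intro polyfun_add polyfun_comp[OF e(2)] c d)
  qed (use c d e in \<open>auto intro!: finitary_Seq finitary_rename finitary_test_second inj_beside\<close>)
qed

lemma inputs_second_0: "inputs [x, y] 1 0 = 0 \<longleftrightarrow> y = []"
  unfolding inputs_def by simp

lemma ptime_if:
  assumes "ptime b" "ptime g" "ptime h"
  shows "ptime (\<lambda>x. if b x \<noteq> [] then g x else h x)"
proof -
  obtain a A where a: "finitary a" "polyfun A" "\<And>x. length (b x) \<le> A (length x)"
    "\<And>x. runs a (inputs [x]) (A (length x)) (inputs [b x])"
    using assms(1) by (auto simp: ptime_def)
  obtain c B where c: "finitary c" "polyfun B" "\<And>x. length (g x) \<le> B (length x)"
    "\<And>x. runs c (inputs [x]) (B (length x)) (inputs [g x])"
    using assms(2) by (auto simp: ptime_def)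
  obtain d D where d: "finitary d" "polyfun D" "\<And>x. length (h x) \<le> D (length x)"
    "\<And>x. runs d (inputs [x]) (D (length x)) (inputs [h x])"
    using assms(3) by (auto simp: ptime_def)
  let ?p = "Seq (test_second a) (Cond (\<lambda>v. v 1 \<noteq> 0) (Seq (move_word 1 {}) c) d)"
  let ?t = "\<lambda>n. (2 + 6 * n + A n) + (1 + ((1 + 3 * A n) + (B n + D n)))"
  show ?thesis
  proof (rule ptimeI[where c = ?p and B = "\<lambda>n. B n + D n" and B' = ?t])
    fix x
    show "length (if b x \<noteq> [] then g x else h x) \<le> B (length x) + D (length x)"
      using c(3)[of x] d(3)[of x] by auto
    have "runs (if inputs [x, b x] 1 0 \<noteq> 0 then Seq (move_word 1 {}) c else d) (inputs [x, b x])
        ((1 + 3 * A (length x)) + (B (length x) + D (length x)))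
        (inputs [if b x \<noteq> [] then g x else h x])"
    proof (cases "b x = []")
      case True
      then show ?thesis using runs_mono[OF d(4)[of x]] inputs_second_0[of x "[]"] by (simp add: inputs_Nil)
    next
      case False
      have "runs (Seq (move_word 1 {}) c) (inputs [x, b x])
          (1 + 3 * length (b x) + B (length x)) (inputs [g x])"
        by (rule runs_Seq[OF runs_clear_second c(4)])
      then have "runs (Seq (move_word 1 {}) c) (inputs [x, b x])
          ((1 + 3 * A (length x)) + (B (length x) + D (length x))) (inputs [g x])"
        by (rule runs_mono) (use a(3)[of x] in simp)
      with False show ?thesis by (simp only: inputs_second_0 if_True simp_thms)
    qed
    then show "runs ?p (inputs [x]) (?t (length x)) (inputs [if b x \<noteq> [] then g x else h x])"
      by (intro runs_Seq[OF runs_test_second[OF a(4)]] runs_Cond) simp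
  next
    show "polyfun (\<lambda>n. B n + D n)" by (intro polyfun_add c d)
    show "polyfun ?t"
      by (intro polyfun_add polyfun_mult polyfun_const polyfun_id a c d)
  qed (use a c d in \<open>auto intro!: finitary_intros finitary_test_second\<close>)
qed

text \<open>A polynomial bound on one application of \<open>F\<close> does not bound its iterates,
  which could double in length each time. Therefore \<open>q\<close> has to bound the number of
  rounds and all lengths along the way, and every round is charged at this common length.\<close>

lemma ptime_while:
  assumes "ptime b" "ptime F" "polyfun q"
    and while: "\<And>x. \<exists>n\<le>q (length x). (\<forall>i<n. b ((F ^^ i) x) \<noteq> []) \<and> b ((F ^^ n) x) = [] \<and>
      (\<forall>i\<le>n. length ((F ^^ i) x) \<le> q (length x)) \<and> f x = (F ^^ n) x"
  shows "ptime f"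
proof -
  obtain a A where a: "finitary a" "polyfun A" "\<And>x. length (b x) \<le> A (length x)"
    "\<And>x. runs a (inputs [x]) (A (length x)) (inputs [b x])"
    using assms(1) by (auto simp: ptime_def)
  obtain c B where c: "finitary c" "polyfun B" "\<And>x. length (F x) \<le> B (length x)"
    "\<And>x. runs c (inputs [x]) (B (length x)) (inputs [F x])"
    using assms(2) by (auto simp: ptime_def)
  let ?body = "Seq (move_word 1 {}) (Seq c (test_second a))"
  let ?loop = "Loop (\<lambda>v. v 1 \<noteq> 0) ?body"
  \<comment> \<open>One round: erase the old test result, apply \<open>F\<close>, test the new
    word.\<close>
  let ?u = "\<lambda>n. (1 + 3 * A n) + (B n + (2 + 6 * n + A n))"
  let ?t = "\<lambda>n. (2 + 6 * q n + A (q n)) + (q n * (1 + ?u (q n)) + 1)"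
  have loop: "runs ?loop (inputs [x, b x]) (n * (1 + ?u m) + 1) (inputs [(F ^^ n) x])"
    if "\<forall>i<n. b ((F ^^ i) x) \<noteq> []" "b ((F ^^ n) x) = []" "\<forall>i\<le>n. length ((F ^^ i) x) \<le> m" for n x m
    using that
  proof (induction n arbitrary: x)
    case 0
    have "runs ?loop (inputs [x, []]) 1 (inputs [x, []])"
      by (rule runs_Loop_False) (simp add: inputs_second_0 del: One_nat_def)
    with 0 show ?case by (simp add: inputs_Nil)
  next
    case (Suc n)
    have x: "length x \<le> m" "b x \<noteq> []" using Suc.prems(1,3) by force+
    have Fx: "length (F x) \<le> m" using Suc.prems(3)[rule_format, of 1] by simp
    have "runs ?loop (inputs [F x, b (F x)]) (n * (1 + ?u m) + 1) (inputs [(F ^^ n) (F x)])"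
    proof (rule Suc.IH)
      show "\<forall>i<n. b ((F ^^ i) (F x)) \<noteq> []" using Suc.prems(1) by (auto simp: funpow_swap1)
      show "b ((F ^^ n) (F x)) = []" using Suc.prems(2) by (simp add: funpow_swap1)
      show "\<forall>i\<le>n. length ((F ^^ i) (F x)) \<le> m"
        using Suc.prems(3)[rule_format, of "Suc i" for i] by (simp add: funpow_swap1)
    qed
    moreover have "runs ?body (inputs [x, b x]) (?u m) (inputs [F x, b (F x)])"
    proof (rule runs_mono)
      show "runs ?body (inputs [x, b x]) ((1 + 3 * length (b x)) + (B (length x) +
          (2 + 6 * length (F x) + A (length (F x))))) (inputs [F x, b (F x)])"
        by (intro runs_Seq[OF runs_clear_second] runs_Seq[OF c(4)] runs_test_second a(4))
      have "length (b x) \<le> A m" "B (length x) \<le> B m" "A (length (F x)) \<le> A m"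
        using a(3)[of x] polyfun_mono[OF a(2) x(1)] polyfun_mono[OF c(2) x(1)]
          polyfun_mono[OF a(2) Fx] by auto
      with Fx show "(1 + 3 * length (b x)) + (B (length x) +
          (2 + 6 * length (F x) + A (length (F x)))) \<le> ?u m" by simp
    qed
    ultimately have "runs ?loop (inputs [x, b x]) (1 + (?u m + (n * (1 + ?u m) + 1)))
        (inputs [(F ^^ n) (F x)])"
      by (intro runs_Loop_True[where s' = "inputs [F x, b (F x)]"])
        (simp_all only: inputs_second_0 x not_False_eq_True)
    then show ?case by (simp add: funpow_swap1 algebra_simps)
  qed
  show ?thesis
  proof (rule ptimeI[where c = "Seq (test_second a) ?loop" and B = q and B' = ?t])
    fix x
    obtain n where n: "n \<le> q (length x)" "\<forall>i<n. b ((F ^^ i) x) \<noteq> []" "b ((F ^^ n) x) = []"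
      "\<forall>i\<le>n. length ((F ^^ i) x) \<le> q (length x)" "f x = (F ^^ n) x"
      using while by blast
    show "length (f x) \<le> q (length x)" using n by auto
    have x: "length x \<le> q (length x)" using n(4)[rule_format, of 0] by simp
    have "runs (Seq (test_second a) ?loop) (inputs [x])
        ((2 + 6 * length x + A (length x)) + (n * (1 + ?u (q (length x))) + 1)) (inputs [f x])"
      unfolding n(5) by (intro runs_Seq[OF runs_test_second[OF a(4)]] loop n)
    then show "runs (Seq (test_second a) ?loop) (inputs [x]) (?t (length x)) (inputs [f x])"
      by (rule runs_mono) (intro add_mono mult_le_mono1 n(1) polyfun_mono[OF a(2)] x order_refl mult_le_mono2)
  next
    have "polyfun (\<lambda>n. ?u (q n))"
      by (intro polyfun_add polyfun_mult polyfun_const polyfun_comp[OF a(2)] polyfun_comp[OF c(2)] assms(3))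
    then show "polyfun ?t"
      by (intro polyfun_add polyfun_mult polyfun_const polyfun_comp[OF a(2)] polyfun_comp[OF c(2)] assms(3))
  qed (use a c assms(3) in \<open>auto intro!: finitary_intros finitary_test_second\<close>)
qed

lemma ptime_id: "ptime (\<lambda>x. x)"
proof (rule ptimeI[where c = "Act (\<lambda>v i. (v i, 0))" and B = "\<lambda>n. n" and B' = "\<lambda>_. 1"])
  show "finitary (Act (\<lambda>v i. (v i, 0)))" by (rule finitary_ActI[of 0 _ 0]) auto
  show "runs (Act (\<lambda>v i. (v i, 0))) (inputs [x]) 1 (inputs [x])" for x
    by (rule runs_Act) simp
qed auto

lemma ptime_Nil: "ptime (\<lambda>_. [])"
proof (rule ptimeI[where c = "move_word 0 {}" and B = "\<lambda>_. 0" and B' = "\<lambda>n. 1 + 3 * n"])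
  show "runs (move_word 0 {}) (inputs [x]) (1 + 3 * length x) (inputs [[]])" for x
    by (rule runs_clear_first)
  show "polyfun (\<lambda>n. 1 + 3 * n)" by (intro polyfun_add polyfun_mult polyfun_const polyfun_id)
qed auto

lemma runs_push_first: "runs (push 0 b) (inputs [x]) 2 (inputs [b # x])"
proof -
  let ?st = "\<lambda>i. if i < length [x] then [x] ! i else []"
  have "inscribe (?st(0 := b # ?st 0)) = inputs [b # x]" by (rule inscribe_inputs) auto
  with runs_push[of 0 b ?st] show ?thesis unfolding inputs_def[of "[x]"] by simp
qed

lemma runs_pop_first: "runs (pop 0) (inputs [x]) 1 (inputs [tl x])"
proof -
  let ?st = "\<lambda>i. if i < length [x] then [x] ! i else []"
  have "inscribe (?st(0 := tl (?st 0))) = inputs [tl x]" by (rule inscribe_inputs) auto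
  with runs_pop[of 0 ?st] show ?thesis unfolding inputs_def[of "[x]"] by simp
qed

lemma ptime_Cons_id: "ptime (\<lambda>x. b # x)"
  by (rule ptimeI[where c = "push 0 b" and B = "\<lambda>n. Suc n" and B' = "\<lambda>_. 2"])
    (auto intro!: runs_push_first polyfun_Suc[OF polyfun_id])

lemma ptime_tl_id: "ptime tl"
  by (rule ptimeI[where c = "pop 0" and B = "\<lambda>n. n" and B' = "\<lambda>_. 1"])
    (auto intro: runs_pop_first[simplified])

lemma inputs_first_0: "inputs [x] 0 0 = (case x of [] \<Rightarrow> 0 | b # w \<Rightarrow> letter b)"
  by (simp add: inputs_def scan_inscribe)

lemma ptime_hd_test: "ptime (\<lambda>x. if x \<noteq> [] \<and> hd x then [True] else [])"
proof (rule ptimeI[where c = "Cond (\<lambda>v. v 0 = 2) (Seq (move_word 0 {}) (push 0 True)) (move_word 0 {})"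
      and B = "\<lambda>_. 1" and B' = "\<lambda>n. 1 + (1 + 3 * n + 2)"])
  fix x :: word
  have "inputs [x] 0 0 = 2 \<longleftrightarrow> x \<noteq> [] \<and> hd x"
    by (auto simp: inputs_first_0 letter_def split: list.split)
  moreover have "runs (Seq (move_word 0 {}) (push 0 True)) (inputs [x]) (1 + 3 * length x + 2) (inputs [[True]])"
    by (rule runs_Seq[OF runs_clear_first runs_push_first])
  moreover have "runs (move_word 0 {}) (inputs [x]) (1 + 3 * length x + 2) (inputs [[]])"
    by (rule runs_mono[OF runs_clear_first]) simp
  ultimately show "runs (Cond (\<lambda>v. v 0 = 2) (Seq (move_word 0 {}) (push 0 True)) (move_word 0 {}))
    (inputs [x]) (1 + (1 + 3 * length x + 2)) (inputs [if x \<noteq> [] \<and> hd x then [True] else []])"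
    by (intro runs_Cond) (simp only: split: if_split, blast)
qed (auto intro!: finitary_intros polyfun_Suc polyfun_mult)

text \<open>The two forms of \<open>g\<close> serve functions with one output and decision problems,
  whose accepting value is \<open>Some []\<close>. A nonempty \<open>F xs\<close> means defined; its
  first letter is a flag that the last step of the machine removes.\<close>

lemma polytime_if_ptimes:
  assumes "ptimes k F"
    and "\<And>xs. length xs = k \<Longrightarrow> g xs = (if F xs = [] then None else Some [tl (F xs)]) \<or>
      g xs = (if F xs = [] then None else Some [])"
  shows "polytime k g"
proof -
  obtain c B where c: "finitary c" "polyfun B"
    "\<And>xs. length xs = k \<Longrightarrow> runs c (inputs xs) (B (total_length xs)) (inputs [F xs])"
    using assms(1) by (auto simp: ptimes_def)
  obtain m' K' where "prog_within m' K' c" using c(1) by (auto simp: finitary_def)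
  \<comment> \<open>\<open>Suc\<close> ensures that tape \<open>0\<close> exists even for
    \<open>k = 0\<close>; the maximum makes room for all inputs.\<close>
  define m K where "m = Suc (max m' k)" and "K = max K' 3"
  have mK: "prog_within m K c" "0 < m" "3 \<le> K" "k \<le> m"
    using prog_within_mono[OF \<open>prog_within m' K' c\<close>, of m K] by (auto simp: m_def K_def)
  have "polyfun (\<lambda>n. B n + 1)" by (intro polyfun_add c(2) polyfun_const)
  then obtain p where p: "poly p = (\<lambda>n. B n + 1)" by (auto simp: polyfun_def)
  have "yields_within (machine m K c) xs (poly p (sum_list (map length xs))) (g xs)"
    if xs: "length xs = k" for xs
  proof -
    have "initial (machine m K c) xs = (2, map (inputs xs) [0..<m])"
      using xs mK(4)
      by (auto simp: initial_def machine_def list_eq_iff_nth_eq nth_append inputs_def inscribe_def)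
    moreover have "\<forall>i\<ge>m. inputs xs i = inscription []"
      using xs mK(4) by (auto simp: inputs_def inscribe_def)
    from machine_run[OF mK(1,2) this c(3)[OF xs]]
    have "(step (machine m K c) ^^ poly p (total_length xs)) (2, map (inputs xs) [0..<m]) =
      (if inputs [F xs] 0 0 = 0 then 1 else 0,
       map ((inputs [F xs])(0 := act (inputs [F xs] 0 0, 1) (inputs [F xs] 0))) [0..<m])"
      unfolding p .
    moreover have "shows_word (act (inputs [F xs] 0 0, 1) (inputs [F xs] 0)) (tl (F xs))" if "F xs \<noteq> []"
    proof -
      obtain b w where bw: "F xs = b # w" using \<open>F xs \<noteq> []\<close> by (cases "F xs") auto
      show ?thesis unfolding bw
        by (auto simp: inputs_def inscribe_def shows_word_def act_def inscription_def nth_Cons nat_add_distrib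
            split: nat.split)
    qed
    moreover have "inputs [F xs] 0 0 = 0 \<longleftrightarrow> F xs = []" by (simp add: inputs_def)
    ultimately show ?thesis
      using assms(2)[OF xs] mK(2) unfolding yields_within_def total_length_def
      by (auto simp: machine_def)
  qed
  moreover have "wf_tm (machine m K c)" "k \<le> tapes (machine m K c)"
    using wf_machine mK by (auto simp: machine_def)
  ultimately show ?thesis unfolding polytime_def by blast
qed

section \<open>Simulating a machine by a program\<close>

text \<open>To simulate an arbitrary machine in a program that can be iterated, its tapes have to be
  erasable. The simulation therefore writes the fresh symbol \<open>symbols M\<close> instead of a blank, so that the
  nonblank cells of a tape always form an interval touching the head. The state is kept as a symbol
  on the additional tape \<open>tapes M\<close>.\<close>

definition unmark :: "nat \<Rightarrow> nat \<Rightarrow> nat" where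
  "unmark K a = (if a = K then 0 else a)"

text \<open>The guard stands still where \<open>delta\<close> is unconstrained, because
  \<open>finitary\<close> speaks about all scanned symbols.\<close>

definition sim_act :: "tm \<Rightarrow> (nat \<Rightarrow> nat) \<Rightarrow> nat \<Rightarrow> nat \<times> int" where
  "sim_act M v i = (let as = map (\<lambda>j. unmark (symbols M) (v j)) [0..<tapes M] in
     if v (tapes M) < states M \<and> set as \<subseteq> {..<symbols M} then
       let r = delta M (v (tapes M)) as in
       if i < tapes M then
         (if fst (snd r ! i) = 0 then symbols M else fst (snd r ! i), snd (snd r ! i))
       else if i = tapes M then (fst r, 0) else (v i, 0)
     else (v i, 0))"

definition simulate :: "tm \<Rightarrow> prog" where
  "simulate M = Loop (\<lambda>v. v (tapes M) \<noteq> accept M \<and> v (tapes M) \<noteq> reject M) (Act (sim_act M))"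

definition interval_tape :: "int \<Rightarrow> int \<Rightarrow> tape \<Rightarrow> bool" where
  "interval_tape a b tp \<longleftrightarrow> (\<forall>j. tp j = 0 \<longleftrightarrow> j < a \<or> b \<le> j)"

text \<open>The nonblank cells are those from \<open>a\<close> to \<open>b - 1\<close>. By
  \<open>a \<le> 1\<close> and \<open>0 \<le> b\<close> the head is inside or next to them, so
  writing a nonblank symbol preserves the interval and the head can find all of it later.\<close>

definition region :: "nat \<Rightarrow> tape \<Rightarrow> bool" where
  "region R tp \<longleftrightarrow> (\<exists>a b. a \<le> 1 \<and> 0 \<le> b \<and> - int R \<le> a \<and> b \<le> int R \<and> interval_tape a b tp)"

definition represents :: "nat \<Rightarrow> nat \<Rightarrow> tape \<Rightarrow> tape \<Rightarrow> bool" where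
  "represents K R tp tp' \<longleftrightarrow> (\<forall>j. tp j = unmark K (tp' j) \<and> unmark K (tp' j) < K) \<and> region R tp'"

definition sim :: "tm \<Rightarrow> nat \<Rightarrow> config \<Rightarrow> store \<Rightarrow> bool" where
  "sim M R = (\<lambda>(q, tps) s. q < states M \<and> length tps = tapes M \<and>
     (\<forall>i<tapes M. represents (symbols M) R (tps ! i) (s i)) \<and>
     s (tapes M) = (inscription [])(0 := q) \<and> (\<forall>i>tapes M. s i = inscription []))"

lemma region_mono: "region R tp \<Longrightarrow> R \<le> R' \<Longrightarrow> region R' tp"
  unfolding region_def by (elim exE conjE, intro exI conjI, assumption+) auto

lemma sim_mono: "sim M R cfg s \<Longrightarrow> R \<le> R' \<Longrightarrow> sim M R' cfg s"
  unfolding sim_def represents_def using region_mono by (auto split: prod.splits)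

lemma interval_tape_write:
  assumes "interval_tape a b tp" "a \<le> 1" "0 \<le> b" "x \<noteq> 0"
  shows "interval_tape (min a 0) (max b 1) (tp(0 := x))"
  unfolding interval_tape_def
proof
  fix j
  have "tp j = 0 \<longleftrightarrow> j < a \<or> b \<le> j" using assms(1) by (auto simp: interval_tape_def)
  with assms(2-) show "(tp(0 := x)) j = 0 \<longleftrightarrow> j < min a 0 \<or> max b 1 \<le> j"
    by (cases "j = 0") (simp, simp, linarith)
qed

lemma interval_tape_shift: "interval_tape a b tp \<Longrightarrow> interval_tape (a - d) (b - d) (\<lambda>j. tp (j + d))"
  unfolding interval_tape_def by auto

lemma act_eq: "act (x, d) tp = (\<lambda>j. (tp(0 := x)) (j + d))"
  by (simp add: act_def)

text \<open>The growth by \<open>2\<close> allows for one cell written next to the interval and one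
  head movement.\<close>

lemma region_act:
  assumes "region R tp" "x \<noteq> 0" "d \<in> {-1, 0, 1}"
  shows "region (R + 2) (act (x, d) tp)"
proof -
  obtain a b where ab: "a \<le> 1" "0 \<le> b" "- int R \<le> a" "b \<le> int R" "interval_tape a b tp"
    using assms(1) by (auto simp: region_def)
  have "interval_tape (min a 0 - d) (max b 1 - d) (act (x, d) tp)"
    unfolding act_eq by (intro interval_tape_shift interval_tape_write ab assms)
  moreover have "min a 0 - d \<le> 1" "0 \<le> max b 1 - d" "- int (R + 2) \<le> min a 0 - d"
    "max b 1 - d \<le> int (R + 2)"
    using ab assms(3) by auto
  ultimately show ?thesis unfolding region_def by blast
qed

lemma represents_act:
  assumes "represents K R tp tp'" "x < K" "d \<in> {-1, 0, 1}"
  shows "represents K (R + 2) (act (x, d) tp) (act (if x = 0 then K else x, d) tp')"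
proof -
  let ?x = "if x = 0 then K else x"
  have tp: "tp j = unmark K (tp' j)" "unmark K (tp' j) < K" and "region R tp'" for j
    using assms(1) by (auto simp: represents_def)
  moreover have "?x \<noteq> 0" using assms(2) by auto
  ultimately have "region (R + 2) (act (?x, d) tp')" using region_act assms(3) by blast
  moreover have "act (x, d) tp j = unmark K (act (?x, d) tp' j) \<and> unmark K (act (?x, d) tp' j) < K" for j
    using assms(2) tp by (cases "j + d = 0") (simp_all add: act_eq unmark_def[of K x] unmark_def[of K K])
  ultimately show ?thesis unfolding represents_def by blast
qed

lemma wf_tm_delta:
  assumes "wf_tm M" "q < states M" "length as = tapes M" "set as \<subseteq> {..<symbols M}"
  shows "fst (delta M q as) < states M" "length (snd (delta M q as)) = tapes M"
    "set (snd (delta M q as)) \<subseteq> {..<symbols M} \<times> {-1, 0, 1}"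
proof -
  obtain q' acts where r: "delta M q as = (q', acts)" by force
  have "case delta M q as of (q', acts) \<Rightarrow>
      q' < states M \<and> length acts = tapes M \<and> set acts \<subseteq> {..<symbols M} \<times> {-1, 0, 1}"
    using assms by (simp only: wf_tm_def)
  then show "fst (delta M q as) < states M" "length (snd (delta M q as)) = tapes M"
    "set (snd (delta M q as)) \<subseteq> {..<symbols M} \<times> {-1, 0, 1}"
    unfolding r by auto
qed

lemma sim_step:
  assumes "wf_tm M" "sim M R (q, tps) s" "q \<noteq> accept M" "q \<noteq> reject M"
  shows "sim M (R + 2) (step M (q, tps)) (\<lambda>i. act (sim_act M (scan s) i) (s i))"
proof -
  let ?m = "tapes M" and ?as = "map (\<lambda>tp. tp 0) tps"
  have s: "q < states M" "length tps = ?m" "\<And>i. i < ?m \<Longrightarrow> represents (symbols M) R (tps ! i) (s i)"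
    "s ?m = (inscription [])(0 := q)" "\<And>i. i > ?m \<Longrightarrow> s i = inscription []"
    using assms(2) by (auto simp: sim_def)
  have as: "map (\<lambda>j. unmark (symbols M) (scan s j)) [0..<?m] = ?as"
    using s(2,3) by (auto simp: list_eq_iff_nth_eq represents_def)
  have sub: "set ?as \<subseteq> {..<symbols M}"
    using s(2,3) by (auto simp: in_set_conv_nth represents_def)
  obtain q' acts where r: "delta M q ?as = (q', acts)" by force
  have q': "q' < states M" "length acts = ?m" "set acts \<subseteq> {..<symbols M} \<times> {-1, 0, 1}"
    using wf_tm_delta[OF assms(1) s(1) _ sub] s(2) r by simp_all
  have act: "sim_act M (scan s) i = (if i < ?m then
      (if fst (acts ! i) = 0 then symbols M else fst (acts ! i), snd (acts ! i))
      else if i = ?m then (q', 0) else (scan s i, 0))" for i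
    unfolding sim_act_def as using s(1,4) sub r by (simp add: Let_def)
  have "represents (symbols M) (R + 2) (map2 act acts tps ! i) (act (sim_act M (scan s) i) (s i))"
    if "i < ?m" for i
  proof -
    have "acts ! i \<in> {..<symbols M} \<times> {-1, 0, 1}" using q'(2,3) that nth_mem by fastforce
    with represents_act[OF s(3)[OF that], of "fst (acts ! i)" "snd (acts ! i)"] show ?thesis
      using that q'(2) s(2) by (auto simp: act mem_Times_iff)
  qed
  then show ?thesis
    using q' s assms(3,4) r unfolding sim_def step_def by (auto simp: act act_eq)
qed

text \<open>Each simulated step costs a test and an action and enlarges the region by
  \<open>2\<close>; one more test ends the loop. If the machine halts before \<open>T\<close>, its
  remaining steps change nothing.\<close>

lemma runs_simulate:
  assumes "wf_tm M" "sim M R cfg s" "fst ((step M ^^ T) cfg) \<in> {accept M, reject M}"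
  shows "\<exists>s'. runs (simulate M) s (2 * T + 1) s' \<and> sim M (R + 2 * T) ((step M ^^ T) cfg) s'"
  using assms(2,3)
proof (induction T arbitrary: R cfg s)
  case 0
  obtain q tps where "cfg = (q, tps)" by force
  with 0 have "s (tapes M) 0 \<in> {accept M, reject M}" by (auto simp: sim_def)
  then have "runs (simulate M) s 1 s" unfolding simulate_def by (intro runs_Loop_False) auto
  with 0 show ?case by auto
next
  case (Suc T)
  obtain q tps where cfg: "cfg = (q, tps)" by force
  have q: "s (tapes M) 0 = q" using Suc.prems(1) by (auto simp: sim_def cfg)
  show ?case
  proof (cases "q = accept M \<or> q = reject M")
    case True
    then have "step M cfg = cfg" by (auto simp: step_def cfg)
    then have stay: "(step M ^^ n) cfg = cfg" for n by (induction n) auto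
    have "runs (simulate M) s 1 s"
      using True q unfolding simulate_def by (intro runs_Loop_False) auto
    then have "runs (simulate M) s (2 * Suc T + 1) s \<and> sim M (R + 2 * Suc T) ((step M ^^ Suc T) cfg) s"
      unfolding stay using sim_mono[OF Suc.prems(1)] runs_mono by simp
    then show ?thesis by blast
  next
    case False
    let ?s = "\<lambda>i. act (sim_act M (scan s) i) (s i)"
    have "sim M (R + 2) (step M cfg) ?s"
      using sim_step[OF assms(1)] Suc.prems(1) False unfolding cfg by blast
    moreover have "fst ((step M ^^ T) (step M cfg)) \<in> {accept M, reject M}"
      using Suc.prems(2) by (simp add: funpow_swap1)
    ultimately obtain s' where s': "runs (simulate M) ?s (2 * T + 1) s'"
      "sim M (R + 2 + 2 * T) ((step M ^^ T) (step M cfg)) s'"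
      using Suc.IH by blast
    have "runs (simulate M) s (1 + (1 + (2 * T + 1))) s'"
      unfolding simulate_def
      by (rule runs_Loop_True[OF _ runs_Act[OF refl] s'(1)[unfolded simulate_def]]) (use False q in auto)
    with s'(2) show ?thesis by (intro exI[of _ s']) (simp add: funpow_swap1)
  qed
qed

lemma finitary_simulate:
  assumes "wf_tm M"
  shows "finitary (simulate M)"
proof -
  \<comment> \<open>The simulation writes the mark \<open>symbols M\<close> as well, and its state
    tape carries state numbers as symbols.\<close>
  let ?m = "tapes M" and ?K = "max (Suc (symbols M)) (states M)"
  have "(i \<ge> Suc ?m \<longrightarrow> sim_act M v i = (v i, 0)) \<and>
    (fst (sim_act M v i) < ?K \<or> fst (sim_act M v i) = v i) \<and> snd (sim_act M v i) \<in> {-1, 0, 1}" for v i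
  proof -
    define as where "as = map (\<lambda>j. unmark (symbols M) (v j)) [0..<?m]"
    define r where "r = delta M (v ?m) as"
    have act: "sim_act M v i = (if v ?m < states M \<and> set as \<subseteq> {..<symbols M} then
       if i < ?m then (if fst (snd r ! i) = 0 then symbols M else fst (snd r ! i), snd (snd r ! i))
       else if i = ?m then (fst r, 0) else (v i, 0)
     else (v i, 0))"
      by (simp add: sim_act_def as_def r_def Let_def)
    show ?thesis
    proof (cases "v ?m < states M \<and> set as \<subseteq> {..<symbols M}")
      case True
      then have r: "fst r < states M" "length (snd r) = ?m" "set (snd r) \<subseteq> {..<symbols M} \<times> {-1, 0, 1}"
        using wf_tm_delta[OF assms, of "v ?m" as] unfolding r_def by (simp_all add: as_def)
      then have "i < ?m \<Longrightarrow> snd r ! i \<in> {..<symbols M} \<times> {-1, 0, 1}" using nth_mem by fastforce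
      with True r show ?thesis unfolding act by (auto simp: mem_Times_iff less_Suc_eq)
    next
      case False
      then show ?thesis unfolding act by auto
    qed
  qed
  then have "finitary (Act (sim_act M))"
    by (intro finitary_ActI[of "Suc ?m" _ ?K]) blast+
  then show ?thesis unfolding simulate_def by (intro finitary_intros)
qed

section \<open>Reading off the output and cleaning the tapes\<close>

definition copy_out :: "nat \<Rightarrow> nat \<Rightarrow> prog" where
  "copy_out e d = Loop (\<lambda>v. v e = 1 \<or> v e = 2)
     (Seq (Act (\<lambda>v i. (v i, if i = d then -1 else 0)))
          (Act (\<lambda>v i. if i = d then (min (v e) 2, 0) else (v i, if i = e then 1 else 0))))"

lemma finitary_copy_out: "finitary (copy_out e d)"
proof -
  have 1: "finitary (Act (\<lambda>v i. (v i, if i = d then -1 else 0)))"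
    by (rule finitary_ActI[of "Suc d" _ 0]) auto
  have 2: "finitary (Act (\<lambda>v i. if i = d then (min (v e) 2, 0) else (v i, if i = e then 1 else 0)))"
    by (rule finitary_ActI[of "Suc (max d e)" _ 3]) auto
  from 1 2 show ?thesis unfolding copy_out_def by (intro finitary_intros)
qed

text \<open>The loop stops at any symbol other than \<open>1\<close> and \<open>2\<close>, since a
  blank that was written is stored as the mark. The word arrives reversed and the head of
  \<open>e\<close> ends behind it; the tape is erased later.\<close>

lemma runs_copy_out:
  assumes "e \<noteq> d" "s d = inscription w" "\<forall>i<length y. s e (int i) = letter (y ! i)"
    "s e (int (length y)) \<notin> {1, 2}"
  shows "runs (copy_out e d) s (1 + 3 * length y)
    (s(d := inscription (rev y @ w), e := (\<lambda>j. s e (j + int (length y)))))"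
  using assms(2-)
proof (induction y arbitrary: s w)
  case Nil
  have "s(d := inscription (rev [] @ w), e := (\<lambda>j. s e (j + int (length [])))) = s"
    using Nil by (auto simp: fun_eq_iff)
  moreover have "runs (copy_out e d) s 1 s"
    unfolding copy_out_def by (rule runs_Loop_False) (use Nil in auto)
  ultimately show ?case by (simp only: list.size mult_0_right add_0_right)
next
  case (Cons b y)
  let ?s = "s(d := inscription (b # w), e := (\<lambda>j. s e (j + 1)))"
  have e: "s e 0 = letter b" using Cons.prems(2)[rule_format, of 0] by simp
  have "runs (copy_out e d) ?s (1 + 3 * length y)
    (?s(d := inscription (rev y @ b # w), e := (\<lambda>j. ?s e (j + int (length y)))))"
  proof (rule Cons.IH)
    show "\<forall>i<length y. ?s e (int i) = letter (y ! i)"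
      using Cons.prems(2)[rule_format, of "Suc i" for i] by (auto simp: add.commute)
  qed (use Cons.prems(3) assms(1) in \<open>auto simp: add.commute\<close>)
  moreover have "?s(d := inscription (rev y @ b # w), e := (\<lambda>j. ?s e (j + int (length y)))) =
      s(d := inscription (rev (b # y) @ w), e := (\<lambda>j. s e (j + int (length (b # y)))))"
    by (auto simp: fun_eq_iff algebra_simps)
  moreover have "runs (Seq (Act (\<lambda>v i. (v i, if i = d then -1 else 0)))
          (Act (\<lambda>v i. if i = d then (min (v e) 2, 0) else (v i, if i = e then 1 else 0)))) s (1 + 1) ?s"
  proof (rule runs_Seq, rule runs_Act, rule refl, rule runs_Act, rule ext)
    fix i
    let ?t = "\<lambda>i. act (s i 0, if i = d then -1 else 0) (s i)"
    have "?t e = s e" using assms(1) by simp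
    then have t: "?t e 0 = letter b" using e by simp
    have "min (letter b) 2 = letter b" by (simp add: letter_def)
    with t show "?s i = act (if i = d then (min (?t e 0) 2, 0) else (?t i 0, if i = e then 1 else 0)) (?t i)"
      using assms(1) Cons.prems(1) \<open>?t e = s e\<close> by (cases "i = d") (simp add: act_push, simp add: act_eq)
  qed
  ultimately have "runs (copy_out e d) s (1 + ((1 + 1) + (1 + 3 * length y)))
      (s(d := inscription (rev (b # y) @ w), e := (\<lambda>j. s e (j + int (length (b # y))))))"
    unfolding copy_out_def by (intro runs_Loop_True) (use e in \<open>auto simp: letter_def split: if_splits\<close>)
  then show ?case by (rule runs_mono) simp
qed

definition move_head :: "nat \<Rightarrow> int \<Rightarrow> prog" where
  "move_head i d = Act (\<lambda>v j. (v j, if j = i then d else 0))"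

definition erase_and_right :: "nat \<Rightarrow> prog" where
  "erase_and_right i = Act (\<lambda>v j. if j = i then (0, 1) else (v j, 0))"

text \<open>Writing \<open>1\<close> puts the head inside the nonblank interval even if the tape was
  blank. The sweep to the left then stops just before the interval, and the sweep to the right
  erases all of it.\<close>

definition erase :: "nat \<Rightarrow> prog" where
  "erase i = Seq (Act (\<lambda>v j. (if j = i then 1 else v j, 0)))
     (Seq (Loop (\<lambda>v. v i \<noteq> 0) (move_head i (-1)))
     (Seq (move_head i 1) (Loop (\<lambda>v. v i \<noteq> 0) (erase_and_right i))))"

lemma runs_move_head: "runs (move_head i d) s 1 (s(i := (\<lambda>j. s i (j + d))))"
  unfolding move_head_def by (rule runs_Act) (auto simp: act_eq fun_eq_iff)

lemma runs_go_left:
  assumes "interval_tape (1 - int n) b (s i)" "1 \<le> b"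
  shows "runs (Loop (\<lambda>v. v i \<noteq> 0) (move_head i (-1))) s (1 + 2 * n) (s(i := (\<lambda>j. s i (j - int n))))"
  using assms
proof (induction n arbitrary: s b)
  case 0
  then show ?case using runs_Loop_False[of "\<lambda>v. v i \<noteq> 0" s] by (simp add: interval_tape_def)
next
  case (Suc n)
  let ?s = "s(i := (\<lambda>j. s i (j + - 1)))"
  have "runs (Loop (\<lambda>v. v i \<noteq> 0) (move_head i (-1))) ?s (1 + 2 * n) (?s(i := (\<lambda>j. ?s i (j - int n))))"
    by (rule Suc.IH[of "b + 1"]) (use Suc.prems interval_tape_shift[OF Suc.prems(1), of "-1"] in auto)
  moreover have "?s(i := (\<lambda>j. ?s i (j - int n))) = s(i := (\<lambda>j. s i (j - int (Suc n))))"
    by (auto simp: algebra_simps)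
  moreover have "s i 0 \<noteq> 0" using Suc.prems by (auto simp: interval_tape_def)
  ultimately have "runs (Loop (\<lambda>v. v i \<noteq> 0) (move_head i (-1))) s (1 + (1 + (1 + 2 * n)))
      (s(i := (\<lambda>j. s i (j - int (Suc n)))))"
    using runs_Loop_True[where b = "\<lambda>v. v i \<noteq> 0", OF _ runs_move_head] by metis
  then show ?case by (rule runs_mono) simp
qed

lemma runs_erase_right:
  assumes "interval_tape 0 (int n) (s i)"
  shows "runs (Loop (\<lambda>v. v i \<noteq> 0) (erase_and_right i)) s (1 + 2 * n) (s(i := inscription []))"
  using assms
proof (induction n arbitrary: s)
  case 0
  then have eq: "s(i := inscription []) = s" and "s i 0 = 0"
    by (auto simp: interval_tape_def fun_eq_iff)
  then have "runs (Loop (\<lambda>v. v i \<noteq> 0) (erase_and_right i)) s 1 s" by (intro runs_Loop_False) simp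
  then show ?case by (simp only: eq mult_0_right add_0_right)
next
  case (Suc n)
  let ?s = "s(i := (\<lambda>j. ((s i)(0 := 0)) (j + 1)))"
  have "runs (Loop (\<lambda>v. v i \<noteq> 0) (erase_and_right i)) ?s (1 + 2 * n) (?s(i := inscription []))"
    by (rule Suc.IH) (use Suc.prems in \<open>auto simp: interval_tape_def\<close>)
  moreover have "runs (erase_and_right i) s 1 ?s"
    unfolding erase_and_right_def by (rule runs_Act) (auto simp: act_eq fun_eq_iff)
  moreover have "s i 0 \<noteq> 0" using Suc.prems by (auto simp: interval_tape_def)
  ultimately have "runs (Loop (\<lambda>v. v i \<noteq> 0) (erase_and_right i)) s (1 + (1 + (1 + 2 * n)))
      (?s(i := inscription []))"
    using runs_Loop_True[where b = "\<lambda>v. v i \<noteq> 0"] by metis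
  then show ?case by (simp only: fun_upd_upd) (rule runs_mono, assumption, simp)
qed

lemma runs_erase:
  assumes "region R (s i)"
  shows "runs (erase i) s (8 + 6 * R) (s(i := inscription []))"
proof -
  obtain a b where ab: "a \<le> 1" "0 \<le> b" "- int R \<le> a" "b \<le> int R" "interval_tape a b (s i)"
    using assms by (auto simp: region_def)
  \<comment> \<open>\<open>A\<close> is the distance to the first blank on the left and
    \<open>B\<close> the number of nonblank cells, both after the scanned cell is written; their
    bounds give \<open>8 + 6 * R\<close>.\<close>
  define A B where "A = nat (1 - min a 0)" and "B = nat (max b 1 - min a 0)"
  have AB: "min a 0 = 1 - int A" "max b 1 - min a 0 = int B" "A \<le> R + 1" "B \<le> 2 * R + 1"
    using ab by (auto simp: A_def B_def)
  define tp where "tp = (s i)(0 := 1)"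
  have tp: "interval_tape (1 - int A) (max b 1) tp"
    using interval_tape_write[OF ab(5,1,2), of 1] unfolding AB tp_def by simp
  have 1: "runs (Act (\<lambda>v j. (if j = i then 1 else v j, 0))) s 1 (s(i := tp))"
    by (rule runs_Act) (auto simp: tp_def act_eq fun_eq_iff)
  have 2: "runs (Loop (\<lambda>v. v i \<noteq> 0) (move_head i (-1))) (s(i := tp)) (1 + 2 * A)
      (s(i := (\<lambda>j. tp (j - int A))))"
    using runs_go_left[of A "max b 1" "s(i := tp)" i] tp by simp
  have 3: "runs (move_head i 1) (s(i := (\<lambda>j. tp (j - int A)))) 1 (s(i := (\<lambda>j. tp (j + (1 - int A)))))"
    using runs_move_head[of i 1 "s(i := (\<lambda>j. tp (j - int A)))"] by (simp add: algebra_simps)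
  have "interval_tape 0 (int B) (\<lambda>j. tp (j + (1 - int A)))"
    using interval_tape_shift[OF tp, of "1 - int A"] AB(1,2) by simp
  then have 4: "runs (Loop (\<lambda>v. v i \<noteq> 0) (erase_and_right i)) (s(i := (\<lambda>j. tp (j + (1 - int A)))))
      (1 + 2 * B) (s(i := inscription []))"
    using runs_erase_right[of B "s(i := (\<lambda>j. tp (j + (1 - int A))))" i] by simp
  show ?thesis
    unfolding erase_def by (rule runs_mono[OF runs_Seq[OF 1 runs_Seq[OF 2 runs_Seq[OF 3 4]]]])
      (use AB in simp)
qed

lemma finitary_erase: "finitary (erase i)"
proof -
  have 1: "finitary (Act (\<lambda>v j. (if j = i then 1 else v j, 0)))"
    by (rule finitary_ActI[of "Suc i" _ 2]) auto
  have 2: "finitary (move_head i d)" if "d \<in> {-1, 1}" for d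
    unfolding move_head_def by (rule finitary_ActI[of "Suc i" _ 2]) (use that in auto)
  have 3: "finitary (erase_and_right i)"
    unfolding erase_and_right_def by (rule finitary_ActI[of "Suc i" _ 2]) auto
  show ?thesis unfolding erase_def using 1 2 3 by (intro finitary_intros) auto
qed

fun erase_below :: "nat \<Rightarrow> prog" where
  "erase_below 0 = Act (\<lambda>v i. (v i, 0))"
| "erase_below (Suc n) = Seq (erase_below n) (erase n)"

lemma finitary_stay: "finitary (Act (\<lambda>v i. (v i, 0)))"
  by (rule finitary_ActI[of 0 _ 0]) auto

lemma runs_stay: "runs (Act (\<lambda>v i. (v i, 0))) s 1 s"
  by (rule runs_Act) simp

lemma finitary_erase_below: "finitary (erase_below n)"
  by (induction n) (auto intro: finitary_stay finitary_Seq finitary_erase)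

lemma runs_erase_below:
  "\<forall>i<n. region R (s i) \<Longrightarrow> runs (erase_below n) s (1 + n * (8 + 6 * R))
    (\<lambda>i. if i < n then inscription [] else s i)"
proof (induction n)
  case 0
  then show ?case using runs_stay[of s] by simp
next
  case (Suc n)
  let ?s = "\<lambda>i. if i < n then inscription [] else s i"
  have "runs (erase n) ?s (8 + 6 * R) (?s(n := inscription []))"
    by (rule runs_erase) (use Suc.prems in simp)
  moreover have "runs (erase_below n) s (1 + n * (8 + 6 * R)) ?s"
    by (rule Suc.IH) (use Suc.prems in simp)
  ultimately have "runs (erase_below (Suc n)) s ((1 + n * (8 + 6 * R)) + (8 + 6 * R)) (?s(n := inscription []))"
    unfolding erase_below.simps by (rule runs_Seq[rotated])
  moreover have "?s(n := inscription []) = (\<lambda>i. if i < Suc n then inscription [] else s i)"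
    by (auto simp: fun_eq_iff less_Suc_eq)
  ultimately show ?case by (simp add: algebra_simps)
qed

definition put_symbol :: "nat \<Rightarrow> nat \<Rightarrow> prog" where
  "put_symbol i a = Act (\<lambda>v j. (if j = i then a else v j, 0))"

lemma runs_put_symbol: "runs (put_symbol i a) s 1 (s(i := (s i)(0 := a)))"
  unfolding put_symbol_def by (rule runs_Act) (auto simp: act_eq fun_eq_iff)

lemma finitary_put_symbol: "finitary (put_symbol i a)"
  unfolding put_symbol_def by (rule finitary_ActI[of "Suc i" _ "Suc a"]) auto

text \<open>The state lies on tape \<open>m\<close>; the output is saved in reverse on tape
  \<open>m + 1\<close>, and moving it to tape \<open>0\<close> restores its order. Acceptance is
  tested twice because the tapes are erased, in either case, between these two moves. With
  \<open>e = m + 2\<close>, a blank tape, the output is empty, as decision problems require.\<close>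

definition embed :: "tm \<Rightarrow> nat \<Rightarrow> prog" where
  "embed M e = (let m = tapes M in
     Seq (put_symbol m (start M)) (Seq (simulate M)
     (Seq (Cond (\<lambda>v. v m = accept M) (copy_out e (m + 1)) (Act (\<lambda>v i. (v i, 0))))
     (Seq (erase_below m)
       (Cond (\<lambda>v. v m = accept M)
         (Seq (put_symbol m 0) (Seq (move_word (m + 1) {0}) (push 0 True))) (put_symbol m 0))))))"

lemma finitary_embed: "wf_tm M \<Longrightarrow> finitary (embed M e)"
  unfolding embed_def Let_def
  by (intro finitary_intros finitary_put_symbol finitary_simulate finitary_copy_out finitary_erase_below
      finitary_stay) simp_all

lemma represents_inscription:
  assumes "3 \<le> K" "length x \<le> R"
  shows "represents K R (inscription x) (inscription x)"
proof -
  have "inscription x j < 3" for j by (auto simp: inscription_def)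
  with assms(1) have "inscription x j < K" for j by (meson less_le_trans)
  then have "inscription x j = unmark K (inscription x j) \<and> unmark K (inscription x j) < K" for j
    unfolding unmark_def by (metis less_irrefl)
  moreover have "interval_tape 0 (int (length x)) (inscription x)"
    by (auto simp: interval_tape_def inscription_def)
  with assms(2) have "region R (inscription x)"
    unfolding region_def by (intro exI[of _ 0] exI[of _ "int (length x)"]) simp
  ultimately show ?thesis unfolding represents_def by blast
qed

lemma sim_initial:
  assumes "wf_tm M" "length xs \<le> tapes M"
  shows "sim M (total_length xs) (initial M xs)
    ((inputs xs)(tapes M := ((inputs xs) (tapes M))(0 := start M)))"
proof -
  have "length x \<le> total_length xs" if "x \<in> set xs" for x
    using that unfolding total_length_def by (simp add: member_le_sum_list)
  then have le: "length (if i < length xs then xs ! i else []) \<le> total_length xs" for i by simp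
  have K: "3 \<le> symbols M" "start M < states M" using assms(1) by (auto simp: wf_tm_def)
  define tps where "tps = map inscription xs @ replicate (tapes M - length xs) (inscription [])"
  have tps: "tps ! i = inscription (if i < length xs then xs ! i else [])" if "i < tapes M" for i
    using that by (auto simp: tps_def nth_append)
  have xs: "inputs xs i = inscription (if i < length xs then xs ! i else [])" for i
    by (simp add: inputs_def inscribe_def)
  have "represents (symbols M) (total_length xs) (tps ! i) (inputs xs i)" if "i < tapes M" for i
    unfolding tps[OF that] xs by (rule represents_inscription[OF K(1) le])
  moreover have "inputs xs i = inscription []" if "i \<ge> tapes M" for i
    using that assms(2) by (simp add: xs)
  ultimately show ?thesis
    using K(2) assms(2) unfolding sim_def initial_def tps_def[symmetric] by (simp add: tps_def)
qed

text \<open>Letters are nonblank, so the nonblank interval reaches at least to the end of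
  \<open>y\<close>, and a head moved behind \<open>y\<close> is still at the interval. Its left end
  is then at most \<open>R + length y\<close> cells away, hence \<open>2 * R\<close>.\<close>

lemma represents_shows_word:
  assumes "represents K R tp tp'" "shows_word tp y" "3 \<le> K"
  shows "\<forall>i<length y. tp' (int i) = letter (y ! i)" "tp' (int (length y)) \<notin> {1, 2}"
    "length y \<le> R" "region (2 * R) (\<lambda>j. tp' (j + int (length y)))"
proof -
  have tp: "tp j = unmark K (tp' j)" for j using assms(1) by (simp add: represents_def)
  have y: "i < length y \<Longrightarrow> tp (int i) = letter (y ! i)" and blank: "tp (int (length y)) = 0" for i
    using assms(2) by (auto simp: shows_word_def)
  show letters: "\<forall>i<length y. tp' (int i) = letter (y ! i)"
  proof (intro allI impI)
    fix i
    assume i: "i < length y"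
    then show "tp' (int i) = letter (y ! i)"
      using y[OF i] tp[of "int i"] by (auto simp: unmark_def split: if_splits)
  qed
  show "tp' (int (length y)) \<notin> {1, 2}"
    using blank tp[of "int (length y)"] assms(3) by (auto simp: unmark_def split: if_splits)
  obtain a b where ab: "a \<le> 1" "0 \<le> b" "- int R \<le> a" "b \<le> int R" "interval_tape a b tp'"
    using assms(1) by (auto simp: represents_def region_def)
  have b: "int (length y) \<le> b"
  proof (cases "length y")
    case (Suc n)
    then have "tp' (int n) \<noteq> 0" using letters by simp
    with ab(5) Suc show ?thesis by (auto simp: interval_tape_def)
  qed (use ab in simp)
  with ab show "length y \<le> R" by simp
  have "interval_tape (a - int (length y)) (b - int (length y)) (\<lambda>j. tp' (j + int (length y)))"
    by (rule interval_tape_shift[OF ab(5)])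
  with ab b show "region (2 * R) (\<lambda>j. tp' (j + int (length y)))"
    unfolding region_def by (intro exI[of _ "a - int (length y)"] exI[of _ "b - int (length y)"]) auto
qed

text \<open>\<open>R\<close> bounds the extent of each tape after \<open>T\<close> simulated steps.
  The time keeps the nesting of \<open>embed\<close>, so that composing the phases yields it
  literally, and both outcomes are charged the same.\<close>

lemma runs_embed:
  assumes M: "wf_tm M" "length xs \<le> tapes M" "yields_within M xs T r"
    and e: "\<And>ys. r = Some ys \<Longrightarrow> (e = tapes M + 2 \<and> out ys = []) \<or> (e < length ys \<and> out ys = ys ! e)"
    and R: "R = total_length xs + 2 * T"
    and F: "F = (case r of None \<Rightarrow> [] | Some ys \<Rightarrow> True # out ys)"
  shows "length F \<le> 1 + R"
    "runs (embed M e) (inputs xs)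
      (1 + ((2 * T + 1) + ((1 + (1 + 3 * R)) + ((1 + tapes M * (8 + 6 * (2 * R))) +
        (1 + (1 + ((1 + 3 * R) + 2))))))) (inputs [F])"
proof -
  let ?m = "tapes M"
  obtain q tps where cfg: "(step M ^^ T) (initial M xs) = (q, tps)" by force
  have q: "q = (if r = None then reject M else accept M)"
    using M(3) cfg by (auto simp: yields_within_def split: option.splits)
  have neq: "accept M \<noteq> reject M" and K: "3 \<le> symbols M" using M(1) by (auto simp: wf_tm_def)
  have 1: "runs (put_symbol ?m (start M)) (inputs xs) 1
      ((inputs xs)(?m := (inputs xs ?m)(0 := start M)))"
    by (rule runs_put_symbol)
  have "q \<in> {accept M, reject M}" by (simp add: q)
  with runs_simulate[OF M(1) sim_initial[OF M(1,2)], of T]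
  obtain s where 2: "runs (simulate M) ((inputs xs)(?m := (inputs xs ?m)(0 := start M))) (2 * T + 1) s"
    and s: "sim M R (q, tps) s"
    unfolding cfg fst_conv R by blast
  have s_m: "s ?m = (inscription [])(0 := q)" and s_gt: "\<And>i. i > ?m \<Longrightarrow> s i = inscription []"
    and s_lt: "\<And>i. i < ?m \<Longrightarrow> represents (symbols M) R (tps ! i) (s i)" and len: "length tps = ?m"
    using s by (auto simp: sim_def)
  have region: "region (2 * R) (s i)" if "i < ?m" for i
    using s_lt[OF that] by (auto simp: represents_def intro: region_mono)
  show "length F \<le> 1 + R" "runs (embed M e) (inputs xs)
      (1 + ((2 * T + 1) + ((1 + (1 + 3 * R)) + ((1 + ?m * (8 + 6 * (2 * R))) +
        (1 + (1 + ((1 + 3 * R) + 2))))))) (inputs [F])"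
  proof (atomize(full), cases r)
    case None
    then have F: "F = []" and q: "q = reject M" using F q by auto
    have 3: "runs (Cond (\<lambda>v. v ?m = accept M) (copy_out e (?m + 1)) (Act (\<lambda>v i. (v i, 0)))) s
        (1 + (1 + 3 * R)) s"
      by (rule runs_Cond) (use s_m q neq runs_mono[OF runs_stay] in simp)
    have 4: "runs (erase_below ?m) s (1 + ?m * (8 + 6 * (2 * R))) (\<lambda>i. if i < ?m then inscription [] else s i)"
      by (rule runs_erase_below) (use region in simp)
    let ?s = "\<lambda>i. if i < ?m then inscription [] else s i"
    have "?s(?m := (?s ?m)(0 := 0)) = inputs [F]"
      unfolding F inputs_def inscribe_def using s_m s_gt by (auto simp: fun_eq_iff not_less)
    then have "runs (put_symbol ?m 0) ?s (1 + ((1 + 3 * R) + 2)) (inputs [F])"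
      using runs_mono[OF runs_put_symbol[of ?m 0 ?s]] by simp
    then have 5: "runs (Cond (\<lambda>v. v ?m = accept M)
        (Seq (put_symbol ?m 0) (Seq (move_word (?m + 1) {0}) (push 0 True))) (put_symbol ?m 0)) ?s
        (1 + (1 + ((1 + 3 * R) + 2))) (inputs [F])"
      by (intro runs_Cond) (use s_m q neq in simp)
    show "length F \<le> 1 + R \<and> runs (embed M e) (inputs xs)
      (1 + ((2 * T + 1) + ((1 + (1 + 3 * R)) + ((1 + ?m * (8 + 6 * (2 * R))) +
        (1 + (1 + ((1 + 3 * R) + 2))))))) (inputs [F])"
      unfolding embed_def Let_def
      using runs_Seq[OF 1 runs_Seq[OF 2 runs_Seq[OF 3 runs_Seq[OF 4 5]]]] F by simp
  next
    case (Some ys)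
    then have F: "F = True # out ys" and q: "q = accept M" using F q by auto
    define y where "y = out ys"
    have out_word: "i < length ys \<Longrightarrow> shows_word (tps ! i) (ys ! i)" and lys: "length ys \<le> ?m" for i
      using M(3) cfg Some len by (auto simp: yields_within_def)
    have e': "e \<noteq> ?m + 1" "e \<noteq> ?m" using e[OF Some] lys by auto
    have "(\<forall>i<length y. s e (int i) = letter (y ! i)) \<and> s e (int (length y)) \<notin> {1, 2} \<and>
        length y \<le> R \<and> (e < ?m \<longrightarrow> region (2 * R) (\<lambda>j. s e (j + int (length y)))) \<and>
        (\<not> e < ?m \<longrightarrow> (\<lambda>j. s e (j + int (length y))) = inscription [])"
    proof (cases "e < ?m")
      case True
      then have "shows_word (tps ! e) y" using e[OF Some] out_word by (auto simp: y_def)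
      from represents_shows_word[OF s_lt[OF True] this K]
      show ?thesis
        using True by blast
    next
      case False
      then have "e = ?m + 2" "y = []" using e[OF Some] lys by (auto simp: y_def)
      then show ?thesis
        using s_gt by (simp add: fun_eq_iff)
    qed
    then have y: "\<forall>i<length y. s e (int i) = letter (y ! i)" "s e (int (length y)) \<notin> {1, 2}"
      "length y \<le> R" "e < ?m \<Longrightarrow> region (2 * R) (\<lambda>j. s e (j + int (length y)))"
      "\<not> e < ?m \<Longrightarrow> (\<lambda>j. s e (j + int (length y))) = inscription []"
      by blast+
    let ?s = "s(?m + 1 := inscription (rev y), e := (\<lambda>j. s e (j + int (length y))))"
    have "runs (copy_out e (?m + 1)) s (1 + 3 * length y) ?s"
      using runs_copy_out[of e "?m + 1" s "[]" y] e' y s_gt by simp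
    then have "runs (copy_out e (?m + 1)) s (1 + 3 * R) ?s"
      by (rule runs_mono) (use y(3) in simp)
    then have 3: "runs (Cond (\<lambda>v. v ?m = accept M) (copy_out e (?m + 1)) (Act (\<lambda>v i. (v i, 0)))) s
        (1 + (1 + 3 * R)) ?s"
      by (intro runs_Cond) (use s_m q in simp)
    let ?t = "\<lambda>i. if i < ?m then inscription [] else ?s i"
    have 4: "runs (erase_below ?m) ?s (1 + ?m * (8 + 6 * (2 * R))) ?t"
      by (rule runs_erase_below) (use region y(4) in simp)
    let ?st = "\<lambda>i. if i = ?m + 1 then rev y else []"
    have t: "?t(?m := (?t ?m)(0 := 0)) = inscribe ?st"
    proof
      fix i
      show "(?t(?m := (?t ?m)(0 := 0))) i = inscribe ?st i"
        using s_m s_gt[of i] e' y(5) by (cases "i < ?m"; cases "i = ?m"; cases "i = e"; cases "i = ?m + 1")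
          (auto simp: inscribe_def fun_eq_iff)
    qed
    have "inscribe (\<lambda>i. if i = ?m + 1 then [] else if i \<in> {0} then rev (?st (?m + 1)) @ ?st i else ?st i)
        = inputs [y]"
      by (rule inscribe_inputs) auto
    then have "runs (move_word (?m + 1) {0}) (inscribe ?st) (1 + 3 * length y) (inputs [y])"
      using runs_move_word[of "?m + 1" "{0}" ?st] by simp
    then have "runs (move_word (?m + 1) {0}) (inscribe ?st) (1 + 3 * R) (inputs [y])"
      by (rule runs_mono) (use y(3) in simp)
    from runs_Seq[OF runs_put_symbol[of ?m 0 ?t, unfolded t] runs_Seq[OF this runs_push_first[of True]]]
    have 5: "runs (Cond (\<lambda>v. v ?m = accept M)
        (Seq (put_symbol ?m 0) (Seq (move_word (?m + 1) {0}) (push 0 True))) (put_symbol ?m 0)) ?t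
        (1 + (1 + ((1 + 3 * R) + 2))) (inputs [F])"
      unfolding F y_def by (intro runs_Cond) (use s_m q e' in simp)
    show "length F \<le> 1 + R \<and> runs (embed M e) (inputs xs)
      (1 + ((2 * T + 1) + ((1 + (1 + 3 * R)) + ((1 + ?m * (8 + 6 * (2 * R))) +
        (1 + (1 + ((1 + 3 * R) + 2))))))) (inputs [F])"
      unfolding embed_def Let_def
      using runs_Seq[OF 1 runs_Seq[OF 2 runs_Seq[OF 3 runs_Seq[OF 4 5]]]] F y(3)
      by (simp add: y_def)
  qed
qed

lemma ptimes_embed:
  assumes "wf_tm M" "k \<le> tapes M"
    and f: "\<And>xs. length xs = k \<Longrightarrow> yields_within M xs (poly p (total_length xs)) (f xs)"
    and e: "\<And>xs ys. length xs = k \<Longrightarrow> f xs = Some ys \<Longrightarrow>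
      (e = tapes M + 2 \<and> out ys = []) \<or> (e < length ys \<and> out ys = ys ! e)"
  shows "ptimes k (\<lambda>xs. case f xs of None \<Rightarrow> [] | Some ys \<Rightarrow> True # out ys)"
proof (rule ptimesI[OF finitary_embed[OF assms(1), of e]])
  let ?R = "\<lambda>n. n + 2 * poly p n"
  let ?B = "\<lambda>n. 1 + ((2 * poly p n + 1) + ((1 + (1 + 3 * ?R n)) +
    ((1 + tapes M * (8 + 6 * (2 * ?R n))) + (1 + (1 + ((1 + 3 * ?R n) + 2))))))"
  show "polyfun (\<lambda>n. 1 + ?R n)" "polyfun ?B"
    by (intro polyfun_add polyfun_mult polyfun_const polyfun_id polyfun_poly)+
  fix xs :: "word list"
  assume xs: "length xs = k"
  show "length (case f xs of None \<Rightarrow> [] | Some ys \<Rightarrow> True # out ys) \<le> 1 + ?R (total_length xs)"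
    using runs_embed(1)[OF assms(1) _ f[OF xs] e[OF xs] refl refl] assms(2) xs by simp
  show "runs (embed M e) (inputs xs) (?B (total_length xs))
      (inputs [case f xs of None \<Rightarrow> [] | Some ys \<Rightarrow> True # out ys])"
    using runs_embed(2)[OF assms(1) _ f[OF xs] e[OF xs] refl refl] assms(2) xs by simp
qed

lemma ptimes_output_if_polytime:
  assumes "polytime k f" "\<And>xs ys. length xs = k \<Longrightarrow> f xs = Some ys \<Longrightarrow> e < length ys"
  shows "ptimes k (\<lambda>xs. case f xs of None \<Rightarrow> [] | Some ys \<Rightarrow> True # ys ! e)"
  using assms(1) ptimes_embed[where e = e and f = f and out = "\<lambda>ys. ys ! e"] assms(2)
  unfolding polytime_def total_length_def by blast

lemma ptimes_defined_if_polytime: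
  assumes "polytime k f"
  shows "ptimes k (\<lambda>xs. if f xs = None then [] else [True])"
proof -
  have "ptimes k (\<lambda>xs. case f xs of None \<Rightarrow> [] | Some ys \<Rightarrow> True # [])"
    using assms ptimes_embed[where f = f and out = "\<lambda>ys. []"]
    unfolding polytime_def total_length_def by blast
  moreover have "(case r of None \<Rightarrow> [] | Some ys \<Rightarrow> True # []) = (if r = None then [] else [True])"
    for r :: "word list option"
    by (cases r) auto
  ultimately show ?thesis by simp
qed

section \<open>Polynomial-time functions of words\<close>

lemma ptime_Cons: "ptime f \<Longrightarrow> ptime (\<lambda>x. b # f x)"
  by (rule ptime_comp[OF ptime_Cons_id])

lemma ptime_tl: "ptime f \<Longrightarrow> ptime (\<lambda>x. tl (f x))"
  by (rule ptime_comp[OF ptime_tl_id])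

lemma ptime_const: "ptime (\<lambda>_. w)"
  by (induction w) (auto intro: ptime_Nil ptime_Cons)

definition ppred :: "(word \<Rightarrow> bool) \<Rightarrow> bool" where
  "ppred P \<longleftrightarrow> ptime (\<lambda>x. if P x then [True] else [])"

lemma ptime_if_ppred:
  assumes "ppred P" "ptime g" "ptime h"
  shows "ptime (\<lambda>x. if P x then g x else h x)"
  using ptime_if[OF assms(1)[unfolded ppred_def] assms(2,3)]
  by (rule back_subst[of ptime]) (simp add: fun_eq_iff)

lemma ppred_not: "ppred P \<Longrightarrow> ppred (\<lambda>x. \<not> P x)"
  unfolding ppred_def[of "\<lambda>x. \<not> P x"]
  by (drule ptime_if_ppred[OF _ ptime_Nil ptime_const[of "[True]"]], erule back_subst[of ptime])
    (simp add: fun_eq_iff)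

lemma ppred_conj: "ppred P \<Longrightarrow> ppred Q \<Longrightarrow> ppred (\<lambda>x. P x \<and> Q x)"
  unfolding ppred_def[of "\<lambda>x. P x \<and> Q x"] ppred_def[of Q]
  by (drule ptime_if_ppred[OF _ _ ptime_Nil], assumption, erule back_subst[of ptime])
    (simp add: fun_eq_iff)

lemma ppred_disj:
  assumes "ppred P" "ppred Q"
  shows "ppred (\<lambda>x. P x \<or> Q x)"
  using ppred_not[OF ppred_conj[OF ppred_not[OF assms(1)] ppred_not[OF assms(2)]]] by simp

lemma ppred_Nil:
  assumes "ptime f"
  shows "ppred (\<lambda>x. f x = [])"
  unfolding ppred_def using ptime_if[OF assms ptime_Nil ptime_const[of "[True]"]]
  by (rule back_subst[of ptime]) (simp add: fun_eq_iff)

definition starts_True :: "word \<Rightarrow> bool" where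
  "starts_True w \<longleftrightarrow> w \<noteq> [] \<and> hd w"

lemma starts_True_simps [simp]: "\<not> starts_True []" "starts_True (b # w) \<longleftrightarrow> b"
  by (simp_all add: starts_True_def)

lemma ppred_starts_True: "ptime f \<Longrightarrow> ppred (\<lambda>x. starts_True (f x))"
  unfolding ppred_def starts_True_def by (rule ptime_comp[OF ptime_hd_test])

lemma ppred_comp: "ppred P \<Longrightarrow> ptime f \<Longrightarrow> ppred (\<lambda>x. P (f x))"
  unfolding ppred_def by (rule ptime_comp)

lemma ptime_Cons_starts_True:
  assumes "ptime f" "ptime g"
  shows "ptime (\<lambda>x. starts_True (f x) # g x)"
  using ptime_if_ppred[OF ppred_starts_True[OF assms(1)]
      ptime_Cons[OF assms(2), of True] ptime_Cons[OF assms(2), of False]]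
  by (rule back_subst[of ptime]) (simp add: fun_eq_iff)

text \<open>The number of iterations is bounded by \<open>\<mu>\<close>, the size of the argument by \<open>S\<close>.\<close>

lemma ptime_tailrec:
  assumes "ppred P" "ptime F" "ptime h"
    and f: "\<And>x. f x = (if P x then f (F x) else h x)"
    and \<mu>: "\<And>x. P x \<Longrightarrow> \<mu> (F x) < \<mu> x" "\<And>x. \<mu> x \<le> q (length x)"
    and S: "\<And>x. P x \<Longrightarrow> S (F x) \<le> S x" "\<And>x. S x \<le> q (length x)" "\<And>x. length x \<le> q (S x)"
    and q: "polyfun q"
  shows "ptime f"
proof -
  define it where "it x = (F ^^ (LEAST n. \<not> P ((F ^^ n) x))) x" for x
  have "\<exists>n\<le>\<mu> x. (\<forall>i<n. P ((F ^^ i) x)) \<and> \<not> P ((F ^^ n) x) \<and> (\<forall>i\<le>n. S ((F ^^ i) x) \<le> S x) \<and>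
      f x = h ((F ^^ n) x)" for x
  proof (induction "\<mu> x" arbitrary: x rule: less_induct)
    case less
    show ?case
    proof (cases "P x")
      case True
      from less[OF \<mu>(1)[OF True]] obtain n where n: "n \<le> \<mu> (F x)" "\<forall>i<n. P ((F ^^ i) (F x))"
        "\<not> P ((F ^^ n) (F x))" "\<forall>i\<le>n. S ((F ^^ i) (F x)) \<le> S (F x)" "f (F x) = h ((F ^^ n) (F x))"
        by blast
      have "P ((F ^^ i) x)" if "i < Suc n" for i
        using that n(2) True by (cases i) (auto simp: funpow_swap1)
      moreover have "S ((F ^^ i) x) \<le> S x" if "i \<le> Suc n" for i
        using that n(4) S(1)[OF True] by (cases i) (auto simp: funpow_swap1 intro: order_trans)
      moreover have "Suc n \<le> \<mu> x" using n(1) \<mu>(1)[OF True] by simp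
      ultimately show ?thesis
        using n(3,5) f[of x] True by (intro exI[of _ "Suc n"]) (simp add: funpow_swap1)
    next
      case False
      with f[of x] show ?thesis by (intro exI[of _ 0]) simp
    qed
  qed
  then obtain n where n: "\<And>x. n x \<le> \<mu> x" "\<And>x i. i < n x \<Longrightarrow> P ((F ^^ i) x)" "\<And>x. \<not> P ((F ^^ n x) x)"
    "\<And>x i. i \<le> n x \<Longrightarrow> S ((F ^^ i) x) \<le> S x" "\<And>x. f x = h ((F ^^ n x) x)"
    by metis
  have "ptime (\<lambda>x. (F ^^ n x) x)"
  \<comment> \<open>\<open>q m\<close> bounds the number of rounds; an iterate has size at most
    \<open>q m\<close>, hence length at most \<open>q (q m)\<close>.\<close>
  proof (rule ptime_while[OF assms(1)[unfolded ppred_def] assms(2), of "\<lambda>m. q m + q (q m)"])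
    show "polyfun (\<lambda>m. q m + q (q m))" by (intro polyfun_add polyfun_comp[OF q] q)
    fix x
    have "length ((F ^^ i) x) \<le> q (length x) + q (q (length x))" if "i \<le> n x" for i
      using S(3)[of "(F ^^ i) x"] polyfun_mono[OF q order_trans[OF n(4)[OF that] S(2)]] by linarith
    moreover have "n x \<le> q (length x) + q (q (length x))" using n(1)[of x] \<mu>(2)[of x] by linarith
    ultimately show "\<exists>m\<le>q (length x) + q (q (length x)).
        (\<forall>i<m. (if P ((F ^^ i) x) then [True] else []) \<noteq> []) \<and>
        (if P ((F ^^ m) x) then [True] else []) = [] \<and>
        (\<forall>i\<le>m. length ((F ^^ i) x) \<le> q (length x) + q (q (length x))) \<and> (F ^^ n x) x = (F ^^ m) x"
      using n(2,3) by (intro exI[of _ "n x"]) auto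
  qed
  from ptime_comp[OF assms(3) this] show ?thesis unfolding n(5)[symmetric] .
qed

definition encode :: "word option \<Rightarrow> word" where
  "encode r = (case r of None \<Rightarrow> [] | Some y \<Rightarrow> True # y)"

lemma encode_simps [simp]: "encode None = []" "encode (Some y) = True # y"
  by (auto simp: encode_def)

lemma encode_eq_Cons [simp]: "encode r = True # y \<longleftrightarrow> r = Some y" "encode r = [] \<longleftrightarrow> r = None"
  by (cases r; simp)+

lemma FP_iff: "f \<in> FP \<longleftrightarrow> ptime (\<lambda>x. encode (f x))"
proof
  assume "f \<in> FP"
  then have "polytime 1 (\<lambda>xs. map_option (\<lambda>y. [y]) (f (xs ! 0)))" by (simp add: FP_def)
  from ptimes_output_if_polytime[OF this, of 0]
  have "ptimes 1 (\<lambda>xs. case map_option (\<lambda>y. [y]) (f (xs ! 0)) of None \<Rightarrow> [] | Some ys \<Rightarrow> True # ys ! 0)"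
    by auto
  also have "(\<lambda>xs. case map_option (\<lambda>y. [y]) (f (xs ! 0)) of None \<Rightarrow> [] | Some ys \<Rightarrow> True # ys ! 0) =
      (\<lambda>xs. encode (f (xs ! 0)))"
    by (auto simp: encode_def split: option.split)
  finally show "ptime (\<lambda>x. encode (f x))" using ptimes_1[of "\<lambda>x. encode (f x)"] by blast
next
  assume "ptime (\<lambda>x. encode (f x))"
  then have "ptimes 1 (\<lambda>xs. encode (f (xs ! 0)))" using ptimes_1[of "\<lambda>x. encode (f x)"] by blast
  then show "f \<in> FP" unfolding FP_def mem_Collect_eq
    by (rule polytime_if_ptimes) (auto simp: encode_def split: option.split)
qed

lemma class_P_iff: "L \<in> class_P \<longleftrightarrow> ppred (\<lambda>x. x \<in> L)"
proof
  assume "L \<in> class_P"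
  then have "polytime 1 (\<lambda>xs. if xs ! 0 \<in> L then Some [] else None)" by (simp add: class_P_def)
  from ptimes_defined_if_polytime[OF this]
  have "ptimes 1 (\<lambda>xs. if xs ! 0 \<in> L then [True] else [])"
    by (rule back_subst[of "ptimes 1"]) (simp add: fun_eq_iff)
  then show "ppred (\<lambda>x. x \<in> L)" unfolding ppred_def by (simp only: ptimes_1[of "\<lambda>x. if x \<in> L then [True] else []"])
next
  assume "ppred (\<lambda>x. x \<in> L)"
  then have "ptimes 1 (\<lambda>xs. if xs ! 0 \<in> L then [True] else [])"
    unfolding ppred_def by (simp only: ptimes_1[of "\<lambda>x. if x \<in> L then [True] else []"])
  then show "L \<in> class_P" unfolding class_P_def mem_Collect_eq
    by (rule polytime_if_ptimes) auto
qed

text \<open>Each component comes from a separate run that returns a single output tape. Where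
  \<open>f\<close> is undefined, both functions yield \<open>[]\<close>.\<close>

lemma FP_to_pairs_ptime:
  assumes "f \<in> FP_to_pairs"
  obtains f1 f2 where "ptime f1" "ptime f2" "\<And>z x y. f z = Some (x, y) \<Longrightarrow> f1 z = x \<and> f2 z = y"
proof -
  define out where "out = (\<lambda>xs. map_option (\<lambda>(x, y). [x, y]) (f (xs ! 0)))"
  have out: "polytime 1 out" using assms by (simp add: FP_to_pairs_def out_def)
  have "ptime (\<lambda>z. tl (case out [z] of None \<Rightarrow> [] | Some ys \<Rightarrow> True # ys ! e))" if "e < 2" for e
  proof (rule ptime_tl)
    have "ptimes 1 (\<lambda>xs. case out xs of None \<Rightarrow> [] | Some ys \<Rightarrow> True # ys ! e)"
      by (rule ptimes_output_if_polytime[OF out]) (use that in \<open>auto simp: out_def\<close>)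
    moreover have "out xs = out [xs ! 0]" for xs by (simp add: out_def)
    ultimately show "ptime (\<lambda>z. case out [z] of None \<Rightarrow> [] | Some ys \<Rightarrow> True # ys ! e)"
      using ptimes_1[of "\<lambda>z. case out [z] of None \<Rightarrow> [] | Some ys \<Rightarrow> True # ys ! e"] by simp
  qed
  from that[OF this[of 0] this[of 1]] show thesis by (simp add: out_def)
qed

section \<open>Several words coded as one\<close>

locale pairing =
  fixes pr :: "word \<times> word \<Rightarrow> word"
  assumes standard: "standard_pairing pr"
begin

definition p1 :: "word \<Rightarrow> word" where "p1 w = fst (inv pr w)"

definition p2 :: "word \<Rightarrow> word" where "p2 w = snd (inv pr w)"

lemma p1_pr [simp]: "p1 (pr (x, y)) = x" and p2_pr [simp]: "p2 (pr (x, y)) = y"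
  using standard by (auto simp: p1_def p2_def standard_pairing_def bij_def)

lemma pr_p1_p2 [simp]: "pr (p1 w, p2 w) = w"
  using standard by (simp add: p1_def p2_def standard_pairing_def bij_def surj_f_inv_f)

lemma pr_eq_iff [simp]: "pr u = pr v \<longleftrightarrow> u = v"
  using standard by (auto simp: standard_pairing_def bij_def inj_eq)

lemma ptime_p1: "ptime f \<Longrightarrow> ptime (\<lambda>x. p1 (f x))" and ptime_p2: "ptime f \<Longrightarrow> ptime (\<lambda>x. p2 (f x))"
proof -
  have "ptime p1" "ptime p2"
    using standard ptime_tl[of "\<lambda>x. True # p1 x"] ptime_tl[of "\<lambda>x. True # p2 x"]
    by (auto simp: standard_pairing_def FP_iff p1_def[abs_def] p2_def[abs_def])
  then show "ptime f \<Longrightarrow> ptime (\<lambda>x. p1 (f x))" "ptime f \<Longrightarrow> ptime (\<lambda>x. p2 (f x))"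
    by (auto intro: ptime_comp)
qed

lemma ptimes_2_if_FP_from_pairs: "\<sigma> \<in> FP_from_pairs \<Longrightarrow> ptimes 2 (\<lambda>xs. encode (\<sigma> (xs ! 0, xs ! 1)))"
proof -
  assume "\<sigma> \<in> FP_from_pairs"
  then have "polytime 2 (\<lambda>xs. map_option (\<lambda>y. [y]) (\<sigma> (xs ! 0, xs ! 1)))" by (simp add: FP_from_pairs_def)
  from ptimes_output_if_polytime[OF this, of 0]
  have "ptimes 2 (\<lambda>xs. case map_option (\<lambda>y. [y]) (\<sigma> (xs ! 0, xs ! 1)) of None \<Rightarrow> [] | Some ys \<Rightarrow> True # ys ! 0)"
    by auto
  also have "(\<lambda>xs. case map_option (\<lambda>y. [y]) (\<sigma> (xs ! 0, xs ! 1)) of None \<Rightarrow> [] | Some ys \<Rightarrow> True # ys ! 0) =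
      (\<lambda>xs. encode (\<sigma> (xs ! 0, xs ! 1)))"
    by (auto simp: encode_def split: option.split)
  finally show ?thesis .
qed

lemma ptimes_pr: "ptimes 2 (\<lambda>xs. pr (xs ! 0, xs ! 1))"
  using ptimes_comp[OF ptime_tl_id ptimes_2_if_FP_from_pairs[of "\<lambda>u. Some (pr u)"]] standard
  by (simp add: standard_pairing_def)

lemma ptime_pr: "ptime f \<Longrightarrow> ptime g \<Longrightarrow> ptime (\<lambda>x. pr (f x, g x))"
  using ptime_comp2[OF ptimes_pr] by simp

lemma FP_from_pairs_iff: "\<sigma> \<in> FP_from_pairs \<longleftrightarrow> ptime (\<lambda>w. encode (\<sigma> (p1 w, p2 w)))"
proof
  assume "\<sigma> \<in> FP_from_pairs"
  from ptime_comp2[OF ptimes_2_if_FP_from_pairs[OF this] ptime_p1[OF ptime_id] ptime_p2[OF ptime_id]]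
  show "ptime (\<lambda>w. encode (\<sigma> (p1 w, p2 w)))" by simp
next
  assume "ptime (\<lambda>w. encode (\<sigma> (p1 w, p2 w)))"
  from ptimes_comp[OF this ptimes_pr] have "ptimes 2 (\<lambda>xs. encode (\<sigma> (xs ! 0, xs ! 1)))" by simp
  then show "\<sigma> \<in> FP_from_pairs" unfolding FP_from_pairs_def mem_Collect_eq
    by (rule polytime_if_ptimes) (auto simp: encode_def split: option.split)
qed

lemma class_P_pairs_iff: "R \<in> class_P_pairs \<longleftrightarrow> ppred (\<lambda>w. (p1 w, p2 w) \<in> R)"
proof
  assume "R \<in> class_P_pairs"
  then have "polytime 2 (\<lambda>xs. if (xs ! 0, xs ! 1) \<in> R then Some [] else None)"
    by (simp add: class_P_pairs_def)
  from ptimes_defined_if_polytime[OF this]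
  have "ptimes 2 (\<lambda>xs. if (xs ! 0, xs ! 1) \<in> R then [True] else [])"
    by (rule back_subst[of "ptimes 2"]) (simp add: fun_eq_iff)
  from ptime_comp2[OF this ptime_p1[OF ptime_id] ptime_p2[OF ptime_id]]
  show "ppred (\<lambda>w. (p1 w, p2 w) \<in> R)" by (simp add: ppred_def)
next
  assume "ppred (\<lambda>w. (p1 w, p2 w) \<in> R)"
  from ptimes_comp[OF this[unfolded ppred_def] ptimes_pr]
  have "ptimes 2 (\<lambda>xs. if (xs ! 0, xs ! 1) \<in> R then [True] else [])" by simp
  then show "R \<in> class_P_pairs" unfolding class_P_pairs_def mem_Collect_eq
    by (rule polytime_if_ptimes) auto
qed

text \<open>A polynomial-time function lengthens its argument at most polynomially. Applied to the
  pairing and to both projections, this makes the length of a code and the lengths of its components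
  interchangeable in polynomial bounds.\<close>

lemma length_pr_bound:
  obtains q where "polyfun q" "\<And>x y. length (pr (x, y)) \<le> q (length x + length y)"
    "\<And>w. length (p1 w) \<le> q (length w)" "\<And>w. length (p2 w) \<le> q (length w)"
proof -
  obtain q0 where q0: "polyfun q0" "\<And>xs. length xs = 2 \<Longrightarrow> length (pr (xs ! 0, xs ! 1)) \<le> q0 (total_length xs)"
    using ptimes_pr unfolding ptimes_def by blast
  obtain q1 where q1: "polyfun q1" "\<And>w. length (p1 w) \<le> q1 (length w)"
    using ptime_length[OF ptime_p1[OF ptime_id]] by blast
  obtain q2 where q2: "polyfun q2" "\<And>w. length (p2 w) \<le> q2 (length w)"
    using ptime_length[OF ptime_p2[OF ptime_id]] by blast
  show thesis
  proof (rule that[of "\<lambda>n. q0 n + (q1 n + q2 n)"])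
    show "polyfun (\<lambda>n. q0 n + (q1 n + q2 n))" by (intro polyfun_add q0 q1 q2)
    show "length (pr (x, y)) \<le> q0 (length x + length y) + (q1 (length x + length y) + q2 (length x + length y))"
      for x y using q0(2)[of "[x, y]"] by (simp add: total_length_def)
    show "length (p1 w) \<le> q0 (length w) + (q1 (length w) + q2 (length w))" for w
      using q1(2)[of w] by simp
    show "length (p2 w) \<le> q0 (length w) + (q1 (length w) + q2 (length w))" for w
      using q2(2)[of w] by simp
  qed
qed

section \<open>Loops on coded tuples\<close>

lemmas ptime_intros = ptime_const ptime_id ptime_Cons_starts_True ptime_Cons ptime_tl ptime_p1 ptime_p2
  ptime_pr ptime_if_ppred

lemmas ppred_intros = ppred_conj ppred_disj ppred_not ppred_Nil ppred_starts_True

text \<open>Equal first letters are stripped from both words in parallel; the words agree iff both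
  become empty together.\<close>

lemma ppred_eq:
  assumes "ptime f" "ptime g"
  shows "ppred (\<lambda>x. f x = g x)"
proof -
  obtain q where q: "polyfun q" "\<And>x y. length (pr (x, y)) \<le> q (length x + length y)"
    "\<And>w. length (p1 w) \<le> q (length w)" "\<And>w. length (p2 w) \<le> q (length w)"
    using length_pr_bound by blast
  have "ptime (\<lambda>w. if p1 w = p2 w then [True] else [])"
  proof (rule ptime_tailrec[where P = "\<lambda>w. \<not> p1 w = [] \<and> \<not> p2 w = [] \<and>
        (starts_True (p1 w) \<and> starts_True (p2 w) \<or> \<not> starts_True (p1 w) \<and> \<not> starts_True (p2 w))"
        and F = "\<lambda>w. pr (tl (p1 w), tl (p2 w))"
        and h = "\<lambda>w. if p1 w = [] \<and> p2 w = [] then [True] else []"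
        and \<mu> = "\<lambda>w. length (p1 w)" and S = "\<lambda>w. length (p1 w) + length (p2 w)" and q = "\<lambda>n. q n + q n"])
    fix w
    show "length w \<le> q (length (p1 w) + length (p2 w)) + q (length (p1 w) + length (p2 w))"
      using q(2)[of "p1 w" "p2 w"] by simp
    show "(if p1 w = p2 w then [True] else []) =
         (if \<not> p1 w = [] \<and> \<not> p2 w = [] \<and>
        (starts_True (p1 w) \<and> starts_True (p2 w) \<or> \<not> starts_True (p1 w) \<and> \<not> starts_True (p2 w))
          then if p1 (pr (tl (p1 w), tl (p2 w))) = p2 (pr (tl (p1 w), tl (p2 w))) then [True] else []
          else if p1 w = [] \<and> p2 w = [] then [True] else [])"
      by (cases "p1 w"; cases "p2 w") auto
    show "length (p1 w) + length (p2 w) \<le> q (length w) + q (length w)"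
      by (intro add_mono q)
    show "length (p1 w) \<le> q (length w) + q (length w)" by (rule trans_le_add1[OF q(3)])
  qed (intro ptime_intros ppred_intros polyfun_add q | simp)+
  then have "ppred (\<lambda>w. p1 w = p2 w)" by (simp add: ppred_def)
  from ppred_comp[OF this ptime_pr[OF assms]] show ?thesis by simp
qed

text \<open>The size measure for loops on coded triples: the length of the code need not follow the
  components step by step, whereas this sum can be computed exactly.\<close>

definition triple_length :: "word \<Rightarrow> nat" where
  "triple_length w = length (p1 w) + (length (p1 (p2 w)) + length (p2 (p2 w)))"

lemma triple_length_pr [simp]: "triple_length (pr (x, pr (y, z))) = length x + (length y + length z)"
  by (simp add: triple_length_def)

lemma triple_length_bound:
  obtains q where "polyfun q" "\<And>w. triple_length w \<le> q (length w)" "\<And>w. length w \<le> q (triple_length w)"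
proof -
  obtain q where q: "polyfun q" "\<And>x y. length (pr (x, y)) \<le> q (length x + length y)"
    "\<And>w. length (p1 w) \<le> q (length w)" "\<And>w. length (p2 w) \<le> q (length w)"
    using length_pr_bound by blast
  let ?Q = "\<lambda>n. (q n + (q (q n) + q (q n))) + q (n + q n)"
  have "triple_length w \<le> ?Q (length w)" for w
    unfolding triple_length_def
    by (intro trans_le_add1 add_mono q order_trans[OF q(3) polyfun_mono[OF q(1) q(4)]]
        order_trans[OF q(4) polyfun_mono[OF q(1) q(4)]])
  moreover have "length w \<le> ?Q (triple_length w)" for w
  proof -
    let ?x = "p1 w" and ?y = "p1 (p2 w)" and ?z = "p2 (p2 w)"
    have "length (pr (?x, pr (?y, ?z))) \<le> q (length ?x + length (pr (?y, ?z)))" by (rule q)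
    also have "\<dots> \<le> q (triple_length w + q (triple_length w))"
      using q(2)[of ?y ?z] polyfun_mono[OF q(1), of "length ?y + length ?z" "triple_length w"]
      by (intro polyfun_mono[OF q(1)] add_mono) (simp_all add: triple_length_def)
    finally show ?thesis by simp
  qed
  moreover have "polyfun ?Q" by (intro polyfun_add polyfun_comp[OF q(1)] polyfun_id q(1))
  ultimately show thesis using that by blast
qed

text \<open>The reversal saves a second loop; the clock \<open>p2 (p2 w)\<close> bounds the length of the word moved.\<close>

definition clocked_append :: "word \<Rightarrow> word" where
  "clocked_append w = (if length (p1 w) \<le> length (p2 (p2 w)) then True # rev (p1 w) @ p1 (p2 w) else [])"

text \<open>A round moves one letter and removes one clock letter, so \<open>triple_length\<close>
  falls by one and bounds both the rounds and the size.\<close>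

lemma ptime_clocked_append: "ptime f \<Longrightarrow> ptime (\<lambda>x. clocked_append (f x))"
proof -
  obtain q where q: "polyfun q" "\<And>w. triple_length w \<le> q (length w)" "\<And>w. length w \<le> q (triple_length w)"
    using triple_length_bound by blast
  have "ptime clocked_append"
  proof (rule ptime_tailrec[where P = "\<lambda>w. \<not> p1 w = [] \<and> \<not> p2 (p2 w) = []"
        and F = "\<lambda>w. pr (tl (p1 w), pr (starts_True (p1 w) # p1 (p2 w), tl (p2 (p2 w))))"
        and h = "\<lambda>w. if p1 w = [] then True # p1 (p2 w) else []"
        and \<mu> = triple_length and S = triple_length and q = q])
    fix w
    show "clocked_append w = (if \<not> p1 w = [] \<and> \<not> p2 (p2 w) = []
        then clocked_append (pr (tl (p1 w), pr (starts_True (p1 w) # p1 (p2 w), tl (p2 (p2 w)))))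
        else if p1 w = [] then True # p1 (p2 w) else [])"
      unfolding clocked_append_def by (cases "p1 w"; cases "p2 (p2 w)") auto
    assume w: "\<not> p1 w = [] \<and> \<not> p2 (p2 w) = []"
    then show "triple_length (pr (tl (p1 w), pr (starts_True (p1 w) # p1 (p2 w), tl (p2 (p2 w))))) < triple_length w"
      unfolding triple_length_pr unfolding triple_length_def by (cases "p1 w"; cases "p2 (p2 w)") auto
    then show "triple_length (pr (tl (p1 w), pr (starts_True (p1 w) # p1 (p2 w), tl (p2 (p2 w))))) \<le> triple_length w"
      by simp
  qed (intro ptime_intros ppred_intros q)+
  then show "ptime f \<Longrightarrow> ptime (\<lambda>x. clocked_append (f x))" by (rule ptime_comp)
qed

text \<open>Moving \<open>f x\<close> onto an empty word with clock \<open>g x\<close> succeeds iff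
  the clock is long enough.\<close>

lemma ppred_length_le:
  assumes "ptime f" "ptime g"
  shows "ppred (\<lambda>x. length (f x) \<le> length (g x))"
proof -
  have "ppred (\<lambda>x. \<not> clocked_append (pr (f x, pr ([], g x))) = [])"
    by (intro ppred_intros ptime_clocked_append ptime_intros assms)
  then show ?thesis by (simp add: clocked_append_def split: if_splits)
qed

text \<open>In unary this is a product plus an offset, the step of Horner's scheme.\<close>

lemma ptime_multiply: "ptime (\<lambda>w. concat (replicate (length (p1 w)) (rev (p1 (p2 w)))) @ p2 (p2 w))"
proof -
  obtain q where q: "polyfun q" "\<And>w. triple_length w \<le> q (length w)" "\<And>w. length w \<le> q (triple_length w)"
    using triple_length_bound by blast
  \<comment> \<open>The product accounts for the letters still to be appended, so \<open>?S\<close>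
    does not grow although the accumulator does.\<close>
  let ?S = "\<lambda>w. length (p1 w) * length (p1 (p2 w)) + triple_length w"
  let ?f = "\<lambda>w. concat (replicate (length (p1 w)) (rev (p1 (p2 w)))) @ p2 (p2 w)"
  let ?F = "\<lambda>w. pr (tl (p1 w), pr (p1 (p2 w), tl (clocked_append (pr (p1 (p2 w), pr (p2 (p2 w), p1 (p2 w)))))))"
  have F: "?F w = pr (tl (p1 w), pr (p1 (p2 w), rev (p1 (p2 w)) @ p2 (p2 w)))" for w
    by (simp add: clocked_append_def)
  show ?thesis
  proof (rule ptime_tailrec[where P = "\<lambda>w. \<not> p1 w = []" and F = ?F
        and h = "\<lambda>w. p2 (p2 w)" and \<mu> = "\<lambda>w. length (p1 w)" and S = ?S and q = "\<lambda>n. q n * q n + q n"])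
    fix w
    have "concat (replicate n v) @ v @ u = v @ concat (replicate n v) @ u" for n and u v :: word
      by (induction n) auto
    then show "?f w = (if \<not> p1 w = [] then ?f (?F w) else p2 (p2 w))"
      unfolding F by (cases "p1 w") auto
    have le: "length (p1 w) \<le> triple_length w" "length (p1 (p2 w)) \<le> triple_length w"
      by (auto simp: triple_length_def)
    show "length (p1 w) \<le> q (length w) * q (length w) + q (length w)"
      using order_trans[OF le(1) q(2)] by simp
    show "?S w \<le> q (length w) * q (length w) + q (length w)"
      by (intro add_mono mult_mono q(2) order_trans[OF le(1) q(2)] order_trans[OF le(2) q(2)]) auto
    have "q (triple_length w) \<le> q (?S w)" by (rule polyfun_mono[OF q(1)]) simp
    with q(3)[of w] show "length w \<le> q (?S w) * q (?S w) + q (?S w)" by linarith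
    assume "\<not> p1 w = []"
    then show "?S (?F w) \<le> ?S w" "length (p1 (?F w)) < length (p1 w)"
      unfolding F triple_length_pr unfolding triple_length_def by (cases "p1 w"; simp)+
  qed (intro ptime_intros ppred_intros ptime_clocked_append polyfun_add polyfun_mult q)+
qed

text \<open>Horner's scheme: for \<open>pCons a p\<close>, the word for \<open>p\<close> is repeated
  \<open>length x\<close> times and \<open>a\<close> letters are added. These words are the clocks
  of searches and length tests.\<close>

lemma ptime_unary:
  assumes "polyfun q"
  obtains f where "ptime f" "\<And>x. length (f x) = q (length x)"
proof -
  have "\<exists>f. ptime f \<and> (\<forall>x. length (f x) = poly p (length x))" for p :: "nat poly"
  proof (induction p)
    case 0
    show ?case using ptime_Nil by force
  next
    case (pCons a p)
    then obtain f where f: "ptime f" "\<And>x. length (f x) = poly p (length x)" by blast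
    have "ptime (\<lambda>x. pr (x, pr (f x, replicate a True)))"
      by (intro ptime_intros f(1))
    from ptime_comp[OF ptime_multiply this] show ?case
      by (intro exI[of _ "\<lambda>x. concat (replicate (length x) (rev (f x))) @ replicate a True"])
        (simp add: length_concat sum_list_replicate f(2))
  qed
  with assms that show thesis unfolding polyfun_def by blast
qed

section \<open>Search for an inverse, letter by letter\<close>

fun search :: "(word \<Rightarrow> bool) \<Rightarrow> word \<Rightarrow> word \<Rightarrow> word \<Rightarrow> word" where
  "search E c u [] = u"
| "search E c u (b # t) =
     (if E (pr (c, pr (u, t))) then search E c u t
      else if E (pr (c, pr (False # u, t))) then search E c (False # u) t
      else search E c (True # u) t)"

text \<open>\<open>E\<close> asks whether at most \<open>length t\<close> more letters in front of
  \<open>u\<close> give a solution, which is thus built from its last letter on. The first test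
  spends a clock letter without adding a letter; this covers solutions shorter than the
  clock.\<close>

lemma search_correct:
  assumes "\<And>u t. E (pr (c, pr (u, t))) \<longleftrightarrow> (\<exists>v. length v \<le> length t \<and> Q (rev v @ u))"
    and "length v \<le> length t" "Q (rev v @ u)"
  shows "Q (search E c u t)"
  using assms(2,3)
proof (induction t arbitrary: u v)
  case Nil
  then show ?case by simp
next
  case (Cons b t)
  show ?case
  proof (cases "E (pr (c, pr (u, t))) \<or> E (pr (c, pr (False # u, t)))")
    case True
    then show ?thesis using assms(1) Cons.IH by auto
  next
    case False
    \<comment> \<open>When the first test fails, a solution must use all letters that the clock
      allows, so \<open>v\<close> is nonempty; its first letter is the one next to
      \<open>u\<close>.\<close>
    then have "\<not> length v \<le> length t" using assms(1) Cons.prems(2) by blast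
    then obtain d v' where v: "v = d # v'" "length v' \<le> length t"
      using Cons.prems(1) by (cases v) auto
    then have "Q (rev v' @ d # u)" using Cons.prems(2) by simp
    moreover have d
    proof (rule ccontr)
      assume "\<not> d"
      with \<open>Q (rev v' @ d # u)\<close> v(2) assms(1)[of "False # u" t] False show False by auto
    qed
    ultimately show ?thesis using False Cons.IH[OF v(2), of "True # u"] by simp
  qed
qed

lemma ptime_search:
  assumes "ppred E"
  shows "ptime (\<lambda>w. search E (p1 w) (p1 (p2 w)) (p2 (p2 w)))"
proof -
  obtain q where q: "polyfun q" "\<And>w. triple_length w \<le> q (length w)" "\<And>w. length w \<le> q (triple_length w)"
    using triple_length_bound by blast
  let ?E = "\<lambda>u w. E (pr (p1 w, pr (u, tl (p2 (p2 w)))))"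
  let ?u = "\<lambda>w. if ?E (p1 (p2 w)) w then p1 (p2 w)
    else if ?E (False # p1 (p2 w)) w then False # p1 (p2 w) else True # p1 (p2 w)"
  let ?F = "\<lambda>w. pr (p1 w, pr (?u w, tl (p2 (p2 w))))"
  show ?thesis
  proof (rule ptime_tailrec[where P = "\<lambda>w. \<not> p2 (p2 w) = []" and F = ?F and h = "\<lambda>w. p1 (p2 w)"
        and \<mu> = "\<lambda>w. length (p2 (p2 w))" and S = triple_length and q = q])
    fix w
    show "search E (p1 w) (p1 (p2 w)) (p2 (p2 w)) = (if \<not> p2 (p2 w) = []
        then search E (p1 (?F w)) (p1 (p2 (?F w))) (p2 (p2 (?F w))) else p1 (p2 w))"
      by (cases "p2 (p2 w)") auto
    show "length (p2 (p2 w)) \<le> q (length w)"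
      using q(2)[of w] by (simp add: triple_length_def)
    assume "\<not> p2 (p2 w) = []"
    then show "length (p2 (p2 (?F w))) < length (p2 (p2 w))" "triple_length (?F w) \<le> triple_length w"
      unfolding triple_length_pr unfolding triple_length_def by (cases "p2 (p2 w)"; simp)+
  qed (intro ptime_intros ppred_intros ppred_comp[OF assms] q)+
qed

lemma ptime_value:
  assumes "\<sigma> \<in> FP_from_pairs" "ptime f" "ptime g"
  shows "ptime (\<lambda>x. encode (\<sigma> (f x, g x)))"
  using ptime_comp2[OF ptimes_2_if_FP_from_pairs[OF assms(1)] assms(2,3)] by simp

text \<open>Whether a suffix extends to some \<open>y\<close> with
  \<open>\<sigma> (x, y) = Some z\<close> is an NP question, witnessed by the missing letters; if P
  = NP, it can serve as the test of the search. By s-honesty some solution fits a polynomial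
  clock.\<close>

lemma invertible_first_if_P_eq_NP:
  assumes "class_P = class_NP" "\<sigma> \<in> FP_from_pairs" "s_honest \<sigma>"
  shows "invertible_first pr \<sigma>"
proof -
  \<comment> \<open>\<open>w\<close> codes \<open>((x, z), (u, t))\<close> and \<open>v\<close>
    lists the missing letters.\<close>
  define R where "R = {(w, v). length v \<le> length (p2 (p2 w)) \<and>
    \<sigma> (p1 (p1 w), rev v @ p1 (p2 w)) = Some (p2 (p1 w))}"
  define E where "E = {w. \<exists>v. (w, v) \<in> R}"
  \<comment> \<open>For \<open>m\<close> coding \<open>(w, v)\<close> this yields
    \<open>rev v @ u\<close> and compares \<open>v\<close> with the clock in one go, which is why
    \<open>R\<close> reverses \<open>v\<close>.\<close>
  let ?a = "\<lambda>m. clocked_append (pr (p2 m, p2 (p1 m)))"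
  have "ppred (\<lambda>m. \<not> ?a m = [] \<and>
      encode (\<sigma> (p1 (p1 (p1 m)), tl (?a m))) = True # p2 (p1 (p1 m)))"
    by (intro ppred_intros ppred_eq ptime_value[OF assms(2)] ptime_clocked_append ptime_intros)
  then have "R \<in> class_P_pairs"
    unfolding class_P_pairs_iff
    by (rule back_subst[of ppred]) (auto simp: fun_eq_iff R_def clocked_append_def)
  moreover obtain q where q: "polyfun q" "\<And>w. length (p2 (p2 w)) \<le> q (length w)"
    using ptime_length[OF ptime_p2[OF ptime_p2[OF ptime_id]]] by blast
  obtain p where "q = poly p" using q(1) by (auto simp: polyfun_def)
  with q(2) have "w \<in> E \<longleftrightarrow> (\<exists>v. length v \<le> poly p (length w) \<and> (w, v) \<in> R)" for w
    unfolding E_def R_def using order_trans by blast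
  ultimately have "E \<in> class_NP" unfolding class_NP_def by blast
  then have E: "ppred (\<lambda>w. w \<in> E)" using assms(1) class_P_iff by simp
  obtain h where h: "\<And>x y z. \<sigma> (x, y) = Some z \<Longrightarrow>
      \<exists>y'. \<sigma> (x, y') = Some z \<and> length y' \<le> poly h (length x + length z)"
    using assms(3) unfolding s_honest_def by blast
  obtain q' where q': "polyfun q'" "\<And>x y. length (pr (x, y)) \<le> q' (length x + length y)"
    "\<And>w. length (p1 w) \<le> q' (length w)" "\<And>w. length (p2 w) \<le> q' (length w)"
    using length_pr_bound by blast
  \<comment> \<open>The inverse receives only the code of \<open>(x, z)\<close>, so the bound on the
    solution is expressed by the length of the code.\<close>
  have "polyfun (\<lambda>n. poly h (q' n + q' n))" by (intro polyfun_comp[OF polyfun_poly] polyfun_add q')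
  then obtain t where t: "ptime t" "\<And>w. length (t w) = poly h (q' (length w) + q' (length w))"
    using ptime_unary by blast
  define g where "g w = search (\<lambda>w. w \<in> E) w [] (t w)" for w
  have "ptime (\<lambda>w. pr (w, pr ([], t w)))" by (intro ptime_intros t)
  from ptime_comp[OF ptime_search[OF E] this] have "ptime g" by (simp add: g_def[abs_def])
  then have "(\<lambda>w. Some (g w)) \<in> FP" by (simp add: FP_iff ptime_Cons)
  moreover have "\<sigma> (x, g (pr (x, z))) = Some z" if xyz: "\<sigma> (x, y) = Some z" for x y z
  proof -
    obtain y' where y': "\<sigma> (x, y') = Some z" "length y' \<le> poly h (length x + length z)"
      using h[OF xyz] by blast
    have "length x + length z \<le> q' (length (pr (x, z))) + q' (length (pr (x, z)))"
      using q'(3,4)[of "pr (x, z)"] by simp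
    from polyfun_mono[OF polyfun_poly this] y'(2)
    have len: "length (rev y') \<le> length (t (pr (x, z)))"
      unfolding t(2) length_rev by (rule order_trans[rotated])
    have E_iff: "pr (pr (x, z), pr (u, t)) \<in> E \<longleftrightarrow>
        (\<exists>v. length v \<le> length t \<and> \<sigma> (x, rev v @ u) = Some z)" for u t
      by (simp only: E_def R_def mem_Collect_eq prod.case p1_pr p2_pr)
    show ?thesis
      unfolding g_def
      by (rule search_correct[where Q = "\<lambda>y. \<sigma> (x, y) = Some z" and v = "rev y'", OF E_iff len])
        (simp add: y'(1))
  qed
  ultimately show ?thesis
    unfolding invertible_first_def by (intro bexI[of _ "\<lambda>w. Some (g w)"]) simp_all
qed

end

section \<open>The one-way function\<close>

text \<open>Ensures that a language outside P has a member, hence that a nontrivial product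
  exists.\<close>

lemma class_P_empty: "{} \<in> class_P"
  by (simp add: class_P_iff ppred_def ptime_Nil)

context pairing
begin

lemma class_P_subset_NP: "class_P \<subseteq> class_NP"
proof
  fix L
  assume "L \<in> class_P"
  then have "ppred (\<lambda>w. p1 w \<in> L)"
    unfolding class_P_iff by (rule ppred_comp) (intro ptime_intros)
  then have "{(x, v). x \<in> L} \<in> class_P_pairs" unfolding class_P_pairs_iff by simp
  moreover have "\<forall>x. x \<in> L \<longleftrightarrow> (\<exists>w. length w \<le> poly 0 (length x) \<and> (x, w) \<in> {(x, v). x \<in> L})" by auto
  ultimately show "L \<in> class_NP" unfolding class_NP_def by blast
qed

text \<open>\<open>V x w\<close> says that \<open>w\<close> is a short witness for \<open>x\<close>. The flag \<open>com\<close> is used as a tag, so that the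
  two orders of the factors give the same value iff \<open>com\<close>.\<close>

definition matches :: "(word \<Rightarrow> word \<Rightarrow> bool) \<Rightarrow> word \<Rightarrow> word \<Rightarrow> word \<Rightarrow> bool" where
  "matches V x a b \<longleftrightarrow> a = False # True # x \<and> (\<exists>w. b = False # False # pr (x, w) \<and> V x w)"

text \<open>Instances carry the tag \<open>False, True\<close>, witnesses
  \<open>False, False\<close>, and \<open>tl (tl a)\<close> removes a tag. The words
  \<open>[True]\<close> and \<open>[False]\<close> are too short to carry one, so their squares do
  not collide with the other products.\<close>

definition owf :: "(word \<Rightarrow> word \<Rightarrow> bool) \<Rightarrow> bool \<Rightarrow> bool \<Rightarrow> bool \<Rightarrow> pfun2" where
  "owf V tot com asc = (\<lambda>(a, b).
     if matches V (tl (tl a)) a b then Some (True # True # tl (tl a))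
     else if matches V (tl (tl b)) b a then Some (True # com # tl (tl b))
     else if \<not> asc \<and> a = b \<and> (a = [True] \<or> a = [False]) then Some [False]
     else if tot then Some [] else None)"

lemma matches_tl: "matches V x a b \<Longrightarrow> tl (tl a) = x"
  by (auto simp: matches_def)

lemma matches_exclusive: "matches V x a b \<Longrightarrow> \<not> matches V y b a"
  by (auto simp: matches_def)

lemma owf_matches: "matches V x a b \<Longrightarrow> owf V tot com asc (a, b) = Some (True # True # x)"
  using matches_tl by (auto simp: owf_def)

lemma owf_matches': "matches V x b a \<Longrightarrow> owf V tot com asc (a, b) = Some (True # com # x)"
  using matches_tl matches_exclusive by (auto simp: owf_def)

lemma owf_Some_cases:
  assumes "owf V tot com asc (a, b) = Some z"
  obtains x where "matches V x a b" "z = True # True # x"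
  | x where "matches V x b a" "z = True # com # x"
  | "\<not> asc" "a = b" "a = [True] \<or> a = [False]" "z = [False]"
  | "tot" "z = []"
proof (cases "matches V (tl (tl a)) a b")
  case True
  with assms show ?thesis by (intro that(1)[of "tl (tl a)"]) (simp_all add: owf_def)
next
  case not_left: False
  show ?thesis
  proof (cases "matches V (tl (tl b)) b a")
    case True
    with assms not_left show ?thesis by (intro that(2)[of "tl (tl b)"]) (simp_all add: owf_def)
  next
    case False
    show ?thesis
    proof (cases "\<not> asc \<and> a = b \<and> (a = [True] \<or> a = [False])")
      case True
      with assms not_left False show ?thesis
        by (intro that(3)) (simp_all add: owf_def split: if_splits)
    next
      case no_square: False
      with assms not_left False show ?thesis
        by (intro that(4)) (simp_all only: owf_def prod.case if_False option.inject split: if_splits, simp_all)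
    qed
  qed
qed

text \<open>A word not starting with \<open>False\<close> occurs in no matching pair; the second
  assumption excludes the square of \<open>[True]\<close>.\<close>

lemma owf_default:
  assumes "\<forall>x c. a \<noteq> False # c" "asc \<or> a = []"
  shows "owf V tot com asc (a, b) = (if tot then Some [] else None)"
    "owf V tot com asc (b, a) = (if tot then Some [] else None)"
  using assms by (auto simp: owf_def matches_def)

lemma is_total_owf: "is_total (owf V tot com asc) \<longleftrightarrow> tot"
proof
  assume "is_total (owf V tot com asc)"
  then have "([], []) \<in> dom (owf V tot com asc)" by (simp add: is_total_def)
  then show tot by (auto simp: owf_def matches_def split: if_splits)
next
  assume tot
  then show "is_total (owf V tot com asc)" by (auto simp: is_total_def owf_def dom_def)
qed

text \<open>One witnessed instance is required: its two products differ unless \<open>com\<close>.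
  If \<open>V\<close> held nowhere, all products would commute.\<close>

lemma commutative_owf:
  assumes "V x w"
  shows "commutative (owf V tot com asc) \<longleftrightarrow> com"
proof
  let ?a = "False # True # x" and ?b = "False # False # pr (x, w)"
  assume "commutative (owf V tot com asc)"
  then have "owf V tot com asc (?a, ?b) = owf V tot com asc (?b, ?a)"
    by (simp add: commutative_def)
  moreover have "matches V x ?a ?b" using assms by (auto simp: matches_def)
  ultimately show com by (simp add: owf_matches owf_matches')
next
  assume com
  have "owf V tot com asc (a, b) = owf V tot com asc (b, a)" for a b
  proof (cases "\<exists>x. matches V x a b \<or> matches V x b a")
    case True
    with \<open>com\<close> show ?thesis by (auto simp: owf_matches owf_matches')
  next
    case False
    then show ?thesis by (auto simp: owf_def)
  qed
  then show "commutative (owf V tot com asc)" by (simp add: commutative_def)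
qed

text \<open>If \<open>asc\<close>, no product is a factor of a nontrivial product, so that all products of three words
  have the default value. Otherwise \<open>A = [True]\<close> and \<open>B = [False]\<close> satisfy \<open>(AA)B = BB = B\<close>, whereas
  \<open>A(AB)\<close> has the default value.\<close>

lemma associative_owf: "associative (owf V tot com asc) \<longleftrightarrow> asc"
proof
  let ?\<sigma> = "owf V tot com asc"
  assume assoc: "associative ?\<sigma>"
  show asc
  proof (rule ccontr)
    assume "\<not> asc"
    then have "?\<sigma> ([True], [True]) = Some [False]" "?\<sigma> ([False], [False]) = Some [False]"
      "?\<sigma> ([True], [False]) = (if tot then Some [] else None)"
      "?\<sigma> ([True], []) = (if tot then Some [] else None)"
      by (auto simp: owf_def matches_def)
    moreover have "hat ?\<sigma> (hat ?\<sigma> (Some [True]) (Some [True])) (Some [False]) =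
        hat ?\<sigma> (Some [True]) (hat ?\<sigma> (Some [True]) (Some [False]))"
      using assoc unfolding associative_def by blast
    ultimately show False by (auto split: if_splits)
  qed
next
  let ?\<sigma> = "owf V tot com asc" and ?d = "if tot then Some [] else None"
  assume asc
  have out: "\<forall>x c. z \<noteq> False # c" if "?\<sigma> (a, b) = Some z" for a b z
    using that by (rule owf_Some_cases) (use \<open>asc\<close> in auto)
  have undef: "\<not> tot" if "?\<sigma> (a, b) = None" for a b
    using that by (simp add: owf_def split: if_splits)
  have "hat ?\<sigma> (?\<sigma> (a, b)) (Some c) = ?d" for a b c
    using owf_default(1)[OF out] \<open>asc\<close> undef by (cases "?\<sigma> (a, b)") auto
  moreover have "hat ?\<sigma> (Some c) (?\<sigma> (a, b)) = ?d" for a b c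
    using owf_default(2)[OF out] \<open>asc\<close> undef by (cases "?\<sigma> (a, b)") auto
  ultimately show "associative ?\<sigma>" unfolding associative_def by simp
qed

text \<open>A nontrivial product contains \<open>x\<close>, and its factors consist of
  \<open>x\<close> and a short witness, so all its preimages are short; only \<open>[]\<close> can
  have long ones.\<close>

lemma owf_short:
  assumes "\<And>x w. V x w \<Longrightarrow> length w \<le> poly p (length x)"
  obtains q where "polyfun q" "\<And>tot com asc a b z. owf V tot com asc (a, b) = Some z \<Longrightarrow>
    (tot \<and> z = []) \<or> length a + length b \<le> q (length z)"
proof -
  obtain q where q: "polyfun q" "\<And>x y. length (pr (x, y)) \<le> q (length x + length y)"
    using length_pr_bound by metis
  \<comment> \<open>\<open>4\<close> counts the two tags, \<open>n\<close> bounds \<open>x\<close>,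
    and the last summand bounds the code of \<open>x\<close> with its witness.\<close>
  let ?Q = "\<lambda>n. n + 4 + q (n + poly p n)"
  have matches: "length a + length b \<le> ?Q (length (True # d # x))" if ab: "matches V x a b" for x a b d
  proof -
    obtain w where w: "a = False # True # x" "b = False # False # pr (x, w)" "V x w"
      using ab by (auto simp: matches_def)
    let ?n = "length (True # d # x)"
    have "length w \<le> poly p ?n"
      by (rule order_trans[OF assms[OF w(3)] polyfun_mono[OF polyfun_poly]]) simp
    then have "q (length x + length w) \<le> q (?n + poly p ?n)"
      by (intro polyfun_mono[OF q(1)] add_mono) simp_all
    with q(2)[of x w] w show ?thesis by simp
  qed
  have "polyfun ?Q" by (intro polyfun_add polyfun_comp[OF q(1)] polyfun_const polyfun_id polyfun_poly)
  moreover have "(tot \<and> z = []) \<or> length a + length b \<le> ?Q (length z)"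
    if "owf V tot com asc (a, b) = Some z" for tot com asc a b z
    using that
  proof (cases rule: owf_Some_cases)
    case (1 x)
    with matches[of x a b True] show ?thesis by simp
  next
    case (2 x)
    with matches[of x b a com] show ?thesis by (simp add: add.commute)
  qed auto
  ultimately show thesis using that by blast
qed

lemma owf_Nil: "tot \<Longrightarrow> owf V tot com asc (a, []) = Some []" "tot \<Longrightarrow> owf V tot com asc ([], a) = Some []"
  using owf_default[of "[]"] by auto

text \<open>Nontrivial values have only short preimages. In the total case \<open>[]\<close> is
  treated apart: any word multiplied by \<open>[]\<close> on either side gives \<open>[]\<close>, so
  the empty word is a short partner.\<close>

lemma
  assumes "\<And>x w. V x w \<Longrightarrow> length w \<le> poly p (length x)"
  shows honest_owf: "honest (owf V tot com asc)" and s_honest_owf: "s_honest (owf V tot com asc)"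
proof -
  let ?\<sigma> = "owf V tot com asc"
  obtain q where q: "polyfun q" "\<And>a b z. ?\<sigma> (a, b) = Some z \<Longrightarrow>
      (tot \<and> z = []) \<or> length a + length b \<le> q (length z)"
    using owf_short[OF assms] by metis
  obtain h where h: "poly h = q" using q(1) by (auto simp: polyfun_def)
  have "\<exists>a' b'. ?\<sigma> (a', b') = Some z \<and> length a' + length b' \<le> q (length z)" if "?\<sigma> (a, b) = Some z" for a b z
  proof (cases "tot \<and> z = []")
    case True
    then show ?thesis using owf_Nil(1)[of tot V com asc "[]"] by (intro exI[of _ "[]"]) auto
  next
    case False
    with q(2)[OF that] that show ?thesis by blast
  qed
  then show "honest ?\<sigma>" unfolding honest_def by (intro exI[of _ h]) (auto simp: ran_def h)
  have "\<exists>b'. ?\<sigma> (a, b') = Some z \<and> length b' \<le> q (length a + length z)" if "?\<sigma> (a, b) = Some z" for a b z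
  proof (cases "tot \<and> z = []")
    case True
    then show ?thesis using owf_Nil(1)[of tot V com asc a] by (intro exI[of _ "[]"]) auto
  next
    case False
    then have "length b \<le> q (length z)" using q(2)[OF that] by auto
    also have "\<dots> \<le> q (length a + length z)" by (rule polyfun_mono[OF q(1)]) simp
    finally show ?thesis using that by blast
  qed
  moreover have "\<exists>a'. ?\<sigma> (a', b) = Some z \<and> length a' \<le> q (length b + length z)" if "?\<sigma> (a, b) = Some z" for a b z
  proof (cases "tot \<and> z = []")
    case True
    then show ?thesis using owf_Nil(2)[of tot V com asc b] by (intro exI[of _ "[]"]) auto
  next
    case False
    then have "length a \<le> q (length z)" using q(2)[OF that] by auto
    also have "\<dots> \<le> q (length b + length z)" by (rule polyfun_mono[OF q(1)]) simp
    finally show ?thesis using that by blast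
  qed
  ultimately show "s_honest ?\<sigma>" unfolding s_honest_def h[symmetric] by blast
qed

lemma owf_in_FP:
  assumes V: "\<And>f g. ptime f \<Longrightarrow> ptime g \<Longrightarrow> ppred (\<lambda>x. V (f x) (g x))"
  shows "owf V tot com asc \<in> FP_from_pairs"
proof -
  have matches: "ppred (\<lambda>x. matches V (tl (tl (f x))) (f x) (g x))" if "ptime f" "ptime g" for f g
  proof -
    \<comment> \<open>The witness is recovered as the second projection, which turns the existential
      quantifier into a decidable condition.\<close>
    have "matches V (tl (tl a)) a b \<longleftrightarrow> a = False # True # tl (tl a) \<and> b = False # False # tl (tl b) \<and>
        p1 (tl (tl b)) = tl (tl a) \<and> V (tl (tl a)) (p2 (tl (tl b)))" for a b
    proof
      assume R: "a = False # True # tl (tl a) \<and> b = False # False # tl (tl b) \<and>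
        p1 (tl (tl b)) = tl (tl a) \<and> V (tl (tl a)) (p2 (tl (tl b)))"
      then have "tl (tl b) = pr (tl (tl a), p2 (tl (tl b)))" by (metis pr_p1_p2)
      with R show "matches V (tl (tl a)) a b" unfolding matches_def by metis
    qed (auto simp: matches_def)
    moreover have "ppred (\<lambda>x. f x = False # True # tl (tl (f x)) \<and> g x = False # False # tl (tl (g x)) \<and>
        p1 (tl (tl (g x))) = tl (tl (f x)) \<and> V (tl (tl (f x))) (p2 (tl (tl (g x)))))"
      by (intro ppred_conj ppred_eq V ptime_intros that)
    ultimately show ?thesis by simp
  qed
  have const: "ppred (\<lambda>_. c)" for c
    unfolding ppred_def by (rule ptime_const)
  have "encode (owf V tot com asc (a, b)) =
     (if matches V (tl (tl a)) a b then True # True # True # tl (tl a)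
     else if matches V (tl (tl b)) b a then True # True # com # tl (tl b)
     else if \<not> asc \<and> a = b \<and> (a = [True] \<or> a = [False]) then [True, False]
     else if tot then [True] else [])" for a b
    by (simp add: owf_def)
  then show ?thesis
    unfolding FP_from_pairs_iff
    by (simp only:) (intro ptime_if_ppred matches const ppred_conj ppred_disj ppred_eq ptime_intros)
qed

lemma ptime_FP_value: "g \<in> FP \<Longrightarrow> ptime f \<Longrightarrow> ptime (\<lambda>x. encode (g (f x)))"
  unfolding FP_iff by (rule ptime_comp)

text \<open>The product, and with it the factor \<open>False # True # x\<close>, can be computed
  from \<open>x\<close> alone, so an inverse of any of the three kinds yields, on members
  \<open>x\<close> of \<open>L\<close>, a pair with that product.\<close>

lemma OWF_owf:
  assumes L: "L \<notin> class_P" "\<And>x. x \<in> L \<longleftrightarrow> (\<exists>w. V x w)"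
    and V: "\<And>x w. V x w \<Longrightarrow> length w \<le> poly p (length x)"
      "\<And>f g. ptime f \<Longrightarrow> ptime g \<Longrightarrow> ppred (\<lambda>x. V (f x) (g x))"
  shows "one_way (owf V tot com asc)" "strong pr (owf V tot com asc)"
    "is_total (owf V tot com asc) \<longleftrightarrow> tot" "commutative (owf V tot com asc) \<longleftrightarrow> com"
    "associative (owf V tot com asc) \<longleftrightarrow> asc"
proof -
  let ?\<sigma> = "owf V tot com asc"
  have FP: "?\<sigma> \<in> FP_from_pairs" using V(2) by (rule owf_in_FP)
  obtain x0 where "x0 \<in> L" using L(1) class_P_empty by fastforce
  then obtain w0 where "V x0 w0" using L(2) by blast
  then show "commutative ?\<sigma> \<longleftrightarrow> com" by (rule commutative_owf)
  show "is_total ?\<sigma> \<longleftrightarrow> tot" by (rule is_total_owf)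
  show "associative ?\<sigma> \<longleftrightarrow> asc" by (rule associative_owf)
  have in_L: "x \<in> L" if "?\<sigma> (a, b) = Some (True # d # x)" for x a b d
    using that by (rule owf_Some_cases) (auto simp: L(2) matches_def)
  have Nil: "?\<sigma> ([], b) \<noteq> Some (True # z)" "?\<sigma> (b, []) \<noteq> Some (True # z)" for b z
    using owf_default[of "[]" asc V tot com b] by auto
  have matches: "\<exists>w. matches V x (False # True # x) (False # False # pr (x, w))" if "x \<in> L" for x
    using that L(2) by (auto simp: matches_def)
  \<comment> \<open>Such functions would decide \<open>L\<close>: outside \<open>L\<close> no pair
    has a value of this form, so it suffices to evaluate \<open>\<sigma>\<close> on the candidates
    and to compare.\<close>
  have contra: False if "ptime f" "ptime g" "\<And>x. x \<in> L \<Longrightarrow> ?\<sigma> (f x, g x) = Some (True # d # x)" for f g d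
  proof -
    have "x \<in> L \<longleftrightarrow> encode (?\<sigma> (f x, g x)) = True # True # d # x" for x
      using that(3) in_L by auto
    moreover have "ppred (\<lambda>x. encode (?\<sigma> (f x, g x)) = True # True # d # x)"
      by (intro ppred_eq ptime_value[OF FP] ptime_intros that)
    ultimately have "ppred (\<lambda>x. x \<in> L)" by simp
    with L(1) show False by (simp add: class_P_iff)
  qed
  have "noninvertible ?\<sigma>"
    unfolding noninvertible_def
  proof (rule notI, elim bexE)
    fix f
    assume f: "f \<in> FP_to_pairs" "\<forall>z\<in>ran ?\<sigma>. \<exists>u. f z = Some u \<and> ?\<sigma> u = Some z"
    obtain f1 f2 where f12: "ptime f1" "ptime f2" "\<And>z x y. f z = Some (x, y) \<Longrightarrow> f1 z = x \<and> f2 z = y"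
      using FP_to_pairs_ptime[OF f(1)] by blast
    show False
    proof (rule contra)
      fix x
      assume "x \<in> L"
      then have "True # True # x \<in> ran ?\<sigma>" using matches owf_matches by (metis ranI)
      then obtain u where "f (True # True # x) = Some u" "?\<sigma> u = Some (True # True # x)" using f(2) by blast
      with f12(3) show "?\<sigma> (f1 (True # True # x), f2 (True # True # x)) = Some (True # True # x)"
        by (cases u) auto
    qed (intro ptime_comp[OF f12(1)] ptime_comp[OF f12(2)] ptime_intros)+
  qed
  moreover have "honest ?\<sigma>" using V(1) by (rule honest_owf)
  ultimately show "one_way ?\<sigma>" using FP by (simp add: one_way_def)
  have "\<not> invertible_first pr ?\<sigma>"
    unfolding invertible_first_def
  proof (rule notI, elim bexE)
    fix g
    assume g: "g \<in> FP" "\<forall>x y z. ?\<sigma> (x, y) = Some z \<longrightarrow> (\<exists>y'. g (pr (x, z)) = Some y' \<and> ?\<sigma> (x, y') = Some z)"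
    show False
    proof (rule contra)
      fix x
      assume "x \<in> L"
      then have "\<exists>w. ?\<sigma> (False # True # x, False # False # pr (x, w)) = Some (True # True # x)"
        using matches owf_matches by blast
      then obtain y' where "g (pr (False # True # x, True # True # x)) = Some y'"
        "?\<sigma> (False # True # x, y') = Some (True # True # x)"
        using g(2) by blast
      then show "?\<sigma> (False # True # x, tl (encode (g (pr (False # True # x, True # True # x))))) =
          Some (True # True # x)" by simp
    qed (intro ptime_FP_value[OF g(1)] ptime_intros)+
  qed
  moreover have "\<not> invertible_second pr ?\<sigma>"
    unfolding invertible_second_def
  proof (rule notI, elim bexE)
    fix g
    assume g: "g \<in> FP" "\<forall>x y z. ?\<sigma> (x, y) = Some z \<longrightarrow> (\<exists>x'. g (pr (y, z)) = Some x' \<and> ?\<sigma> (x', y) = Some z)"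
    show False
    proof (rule contra)
      fix x
      assume "x \<in> L"
      then have "\<exists>w. ?\<sigma> (False # False # pr (x, w), False # True # x) = Some (True # com # x)"
        using matches owf_matches' by blast
      then obtain x' where "g (pr (False # True # x, True # com # x)) = Some x'"
        "?\<sigma> (x', False # True # x) = Some (True # com # x)"
        using g(2) by blast
      then show "?\<sigma> (tl (encode (g (pr (False # True # x, True # com # x)))), False # True # x) =
          Some (True # com # x)" by simp
    qed (intro ptime_FP_value[OF g(1)] ptime_intros)+
  qed
  moreover have "s_honest ?\<sigma>" using V(1) by (rule s_honest_owf)
  ultimately show "strong pr ?\<sigma>" using FP by (simp add: strong_def strongly_noninvertible_def)
qed

lemma OWF_exists_if_P_neq_NP:
  assumes "class_P \<noteq> class_NP"
  shows "\<exists>\<sigma>. OWF pr Y t c a \<sigma>"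
proof -
  obtain L where L: "L \<notin> class_P" "L \<in> class_NP" using assms class_P_subset_NP by blast
  then obtain R p where R: "R \<in> class_P_pairs"
    "\<And>x. x \<in> L \<longleftrightarrow> (\<exists>w. length w \<le> poly p (length x) \<and> (x, w) \<in> R)"
    unfolding class_NP_def by blast
  \<comment> \<open>With the length bound inside \<open>V\<close>, witnesses are short by
    definition; the word \<open>u x\<close> turns this bound into a decidable comparison of
    lengths.\<close>
  define V where "V x w \<longleftrightarrow> length w \<le> poly p (length x) \<and> (x, w) \<in> R" for x w
  obtain u where u: "ptime u" "\<And>x. length (u x) = poly p (length x)"
    using ptime_unary[OF polyfun_poly] by blast
  have "ppred (\<lambda>x. V (f x) (g x))" if "ptime f" "ptime g" for f g
  proof -
    have "ppred (\<lambda>x. (p1 (pr (f x, g x)), p2 (pr (f x, g x))) \<in> R)"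
      using R(1) unfolding class_P_pairs_iff by (rule ppred_comp) (intro ptime_intros that)
    moreover have "ppred (\<lambda>x. length (g x) \<le> length (u (f x)))"
      by (intro ppred_length_le ptime_comp[OF u(1)] that)
    ultimately show ?thesis using ppred_conj unfolding V_def u(2) p1_pr p2_pr by blast
  qed
  with R(2) have "one_way (owf V tot com asc) \<and> strong pr (owf V tot com asc) \<and>
    (is_total (owf V tot com asc) \<longleftrightarrow> tot) \<and> (commutative (owf V tot com asc) \<longleftrightarrow> com) \<and>
    (associative (owf V tot com asc) \<longleftrightarrow> asc)" for tot com asc
    by (intro conjI OWF_owf[where V = V, OF L(1)]) (auto simp: V_def)
  moreover have "\<exists>b. meets r b" for r by (cases r) (auto intro: exI[of _ True] exI[of _ False])
  then obtain b where "\<And>r. meets r (b r)" by metis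
  ultimately have "OWF pr Y t c a (owf V (b t) (b c) (b a))" unfolding OWF_def by simp
  then show ?thesis by blast
qed

end

theorem theorem9:
  fixes pr :: "word \<times> word \<Rightarrow> word" and t c a :: requirement
  assumes "standard_pairing pr"
  shows "(\<exists>\<sigma>. OWF pr Y t c a \<sigma>) \<longleftrightarrow> class_P \<noteq> class_NP"
proof -
  interpret pairing pr by standard (rule assms)
  \<comment> \<open>Strength forbids inversion on either side, so an inverse on one side contradicts
    it.\<close>
  have False if "OWF pr Y t c a \<sigma>" "class_P = class_NP" for \<sigma>
  proof -
    have "strong pr \<sigma>" using that(1) by (simp add: OWF_def)
    then show False
      using invertible_first_if_P_eq_NP[OF that(2), of \<sigma>]
      by (simp add: strong_def strongly_noninvertible_def)
  qed
  with OWF_exists_if_P_neq_NP show ?thesis by blast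
qed

end
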